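(* Let $n\ge 3$ and $k$ be integers with $1\leq k\leq \lfloor \frac{n-1}{2} \rfloor$. Then $$Ar(P_{n,k},C_5)=\begin{cases} 7, & \text{if } (n,k)=(3,1);\\ 13, & \text{if } (n,k)=(5,1);\\ 10, & \text{if } (n,k)=(5,2);\\ 22, & \text{if } (n,k)=(10,2);\\ \lfloor \frac{7n}{3} \rfloor, & \text{if } (n\geq 6,\ n\neq 10 \text{ and } k=2), \text{ or } (k=\frac{n-1}{2}\ge 3);\\ \frac{14n}{5}, & \text{if } k\geq 3 \text{ and } k\in\{\frac{n}{5},\frac{2n}{5}\};\\ 3n, & \text{otherwise.} \end{cases}$$
   Context: For integers $n\ge 3$ and $1\le k\le \lfloor \frac{n-1}{2}\rfloor$, the generalized Petersen graph $P_{n,k}$ is the simple graph with vertex set $\{u_i,v_i : 0\leq i\leq n-1\}$ ($2n$ distinct vertices) and edge set $\{u_iu_{i+1},\,u_iv_i,\,v_iv_{i+k} : 0\leq i\leq n-1\}$, subscripts taken modulo $n$; it has $3n$ edges. $C_d$ denotes the cycle on $d$ vertices. An edge-coloring of a graph $G$ is an arbitrary map from $E(G)$ to a set of colors (not necessarily proper); the number of colors of the coloring is the number of colors actually used. A copy of $H$ in $G$ is a (not necessarily induced) subgraph of $G$ isomorphic to $H$; it is rainbow if its edges receive pairwise distinct colors. The anti-Ramsey number $Ar(G,H)$ is the maximum number of colors in an edge-coloring of $G$ which has no rainbow copy of $H$; if $G$ contains no copy of $H$, then $Ar(G,H)=|E(G)|$. *)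

theory Defs
  imports Complex_Main
begin

text \<open>A graph is given by its vertex set and its edge set, an edge being the set of its two ends.\<close>

type_synonym 'a ugraph = "'a set \<times> 'a set set"

abbreviation verts :: "'a ugraph \<Rightarrow> 'a set" where "verts \<equiv> fst"

abbreviation edges :: "'a ugraph \<Rightarrow> 'a set set" where "edges \<equiv> snd"

definition simple_graph :: "'a ugraph \<Rightarrow> bool" where
  "simple_graph G \<longleftrightarrow> (\<forall>e\<in>edges G. e \<subseteq> verts G \<and> card e = 2)"

definition subgraph :: "'a ugraph \<Rightarrow> 'a ugraph \<Rightarrow> bool" where
  "subgraph K G \<longleftrightarrow> simple_graph K \<and> verts K \<subseteq> verts G \<and> edges K \<subseteq> edges G"

definition graph_iso :: "'a ugraph \<Rightarrow> 'b ugraph \<Rightarrow> bool" where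
  "graph_iso G H \<longleftrightarrow>
     (\<exists>f. bij_betw f (verts G) (verts H) \<and>
          (\<forall>x\<in>verts G. \<forall>y\<in>verts G. {x, y} \<in> edges G \<longleftrightarrow> {f x, f y} \<in> edges H))"

definition is_copy :: "'b ugraph \<Rightarrow> 'a ugraph \<Rightarrow> 'a ugraph \<Rightarrow> bool" where
  "is_copy H G K \<longleftrightarrow> subgraph K G \<and> graph_iso K H"

definition rainbow :: "('a set \<Rightarrow> 'c) \<Rightarrow> 'a ugraph \<Rightarrow> bool" where
  "rainbow c K \<longleftrightarrow> inj_on c (edges K)"

text \<open>
  Colours are natural numbers, which is no restriction for a graph with finitely many edges;
  the values of a colouring outside the edge set are irrelevant. If \<open>G\<close> contains no copy of
  \<open>H\<close>, then every colouring is admissible and the maximum is the number of edges of \<open>G\<close>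
  (see below). The maximum is meaningful only if \<open>G\<close> has finitely many edges and some colouring
  is admissible, e.g. if \<open>H\<close> has at least two edges.
\<close>

definition anti_ramsey :: "'a ugraph \<Rightarrow> 'b ugraph \<Rightarrow> nat" where
  "anti_ramsey G H =
     Max {card (c ` edges G) | c :: 'a set \<Rightarrow> nat. \<not> (\<exists>K. is_copy H G K \<and> rainbow c K)}"

definition cycle_graph :: "nat \<Rightarrow> nat ugraph" where
  "cycle_graph d = ({..<d}, {{i, (i + 1) mod d} | i. i < d})"

datatype petersen_vertex = U nat | V nat

definition gen_petersen :: "nat \<Rightarrow> nat \<Rightarrow> petersen_vertex ugraph" where
  "gen_petersen n k =
     (U ` {..<n} \<union> V ` {..<n},
      {{U i, U ((i + 1) mod n)} | i. i < n} \<union>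
      {{U i, V i} | i. i < n} \<union>
      {{V i, V ((i + k) mod n)} | i. i < n})"

lemma anti_ramsey_no_copy:
  assumes fin: "finite (edges G)" and none: "\<nexists>K. is_copy H G K"
  shows "anti_ramsey G H = card (edges G)"
proof -
  let ?S = "{card (c ` edges G) | c :: 'a set \<Rightarrow> nat. \<not> (\<exists>K. is_copy H G K \<and> rainbow c K)}"
  obtain c :: "'a set \<Rightarrow> nat" where c: "inj_on c (edges G)"
    using finite_imp_inj_to_nat_seg[OF fin] by blast
  have le: "x \<le> card (edges G)" if "x \<in> ?S" for x
    using that card_image_le[OF fin] by auto
  have "card (c ` edges G) \<in> ?S"
    using none by blast
  then have "card (edges G) \<in> ?S"
    using card_image[OF c] by simp
  moreover have "finite ?S"
    using le by (meson finite_nat_set_iff_bounded_le)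
  ultimately show ?thesis
    unfolding anti_ramsey_def using le by (intro Max_eqI) auto
qed

end

theory Submission
  imports Defs
begin

text \<open>
  The edges of the generalized Petersen graph fall into three classes of $n$ edges each: outer edges
  \<open>u\<^sub>iu\<^sub>i\<^sub>+\<^sub>1\<close>, spokes \<open>u\<^sub>iv\<^sub>i\<close> and inner edges \<open>v\<^sub>iv\<^sub>i\<^sub>+\<^sub>k\<close>. The colouring problem depends on
  the graph only through the hypergraph that its pentagons form on these $3n$ edges.

  A pentagon has an even number of spokes, and four are too many. Without spokes it is the outer
  cycle ($n = 5$) or closes up after five inner steps ($n$ divides $5k$, so $k = n/5$ or $k = 2n/5$).
  With two spokes it has two outer edges and one inner edge ($k = 2$, or the prism $n = 3$), or one
  outer edge and two inner edges ($n = 2k + 1$). Since a step in the opposite direction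
  returns to the previous vertex, all steps within a run go the same way, which makes the
  classification (\<open>pentagons_iff\<close>) a matter of congruences.

  For the upper bounds, let the defect of a colouring be the number of edges minus the number of
  colours. A colour class with $m$ edges contributes $m - 1$ to the defect, and it prevents a pentagon
  from being rainbow exactly when it contains two of its edges. If every edge lies in at most $d$
  pentagons, double counting shows that $m$ edges can spoil at most $dm/2$ of them. When $d = 2$ and
  two edges determine the pentagon containing them both, a pair of edges spoils at most one pentagon
  and $m \ge 3$ edges at most $m$, so the defect is at least two thirds of the number of pentagons
  (\<open>colours_le_two_faced\<close>). This covers $k = 2$, $n \ge 6$, where there are $n$ pentagons, or $12$ for
  the dodecahedron $n = 10$. For $k = (n-1)/2 \ge 3$ the graph is isomorphic to the one
  with $k = 2$, by an exchange of the outer and the inner rim. Disjoint pentagons cost one colour each, and the prism has $6$ pentagons and $d = 4$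
  (\<open>colours_le_degree\<close>). The Petersen graph is more delicate: there $d = 4$ and two
  edges share at most two pentagons, which only gives defect at least $4$, and equality would force
  two classes of three edges such that no pentagon meets both, although every edge shares a
  pentagon with all but two of the other edges (\<open>colours_le_petersen_type\<close>).

  For the lower bounds with $k = 2$ and $n \ge 6$, the efficient colour classes are stars of three edges
  at a vertex that lies on three pentagons, all of which they spoil. These stars are chosen so that no
  two spoil the same pentagon, and a remainder of at most two pentagons is spoiled by pairs. In the
  Petersen graph a single class of six edges works, namely the edge cut around the closed neighbourhood of a vertex.
\<close>

section \<open>Pentagons and the hypergraph of their edge sets\<close>

definition five_cycles :: "'a ugraph \<Rightarrow> 'a set set set" where
  "five_cycles G = {{{a, b}, {b, c}, {c, d}, {d, e}, {e, a}} | a b c d e.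
     distinct [a, b, c, d, e] \<and> {{a, b}, {b, c}, {c, d}, {d, e}, {e, a}} \<subseteq> edges G}"

lemma five_cyclesI:
  assumes "distinct [a, b, c, d, e]" "{{a, b}, {b, c}, {c, d}, {d, e}, {e, a}} \<subseteq> edges G"
  shows "{{a, b}, {b, c}, {c, d}, {d, e}, {e, a}} \<in> five_cycles G"
  unfolding five_cycles_def using assms
  by (intro CollectI exI[of _ a] exI[of _ b] exI[of _ c] exI[of _ d] exI[of _ e] conjI refl)

lemma five_cyclesE:
  assumes "S \<in> five_cycles G"
  obtains a b c d e where "S = {{a, b}, {b, c}, {c, d}, {d, e}, {e, a}}"
    "distinct [a, b, c, d, e]" "{{a, b}, {b, c}, {c, d}, {d, e}, {e, a}} \<subseteq> edges G"
  using assms unfolding five_cycles_def mem_Collect_eq by (elim exE conjE)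

text \<open>
  The anti-Ramsey problem for a hypergraph: a colouring of \<open>E\<close> is admissible if it is injective on no
  member of \<open>\<P>\<close>.
\<close>

definition max_colours :: "'e set \<Rightarrow> 'e set set \<Rightarrow> nat" where
  "max_colours E \<P> = Max {card (c ` E) | c :: 'e \<Rightarrow> nat. \<forall>S\<in>\<P>. \<not> inj_on c S}"

lemma edges_cycle_graph_5:
  "edges (cycle_graph 5) = {{0, 1}, {1, 2}, {2, 3}, {3, 4}, {4, 0}}"
proof -
  have "{..<5} = {0, 1, 2, 3, 4::nat}"
    by auto
  moreover have "edges (cycle_graph 5) = (\<lambda>i. {i, (i + 1) mod 5}) ` {..<5}"
    by (auto simp: cycle_graph_def)
  ultimately show ?thesis
    by (simp add: numeral_2_eq_2)
qed

lemma copy_of_five_cycle: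
  assumes "simple_graph G"
    and dist: "distinct [a, b, c, d, e]"
    and sub: "{{a, b}, {b, c}, {c, d}, {d, e}, {e, a}} \<subseteq> edges G"
  shows "is_copy (cycle_graph 5) G ({a, b, c, d, e}, {{a, b}, {b, c}, {c, d}, {d, e}, {e, a}})"
proof -
  define f :: "'a \<Rightarrow> nat" where
    "f x = (if x = a then 0 else if x = b then 1 else if x = c then 2 else if x = d then 3 else 4)"
    for x
  have ne: "a \<noteq> b" "a \<noteq> c" "a \<noteq> d" "a \<noteq> e" "b \<noteq> c" "b \<noteq> d" "b \<noteq> e" "c \<noteq> d" "c \<noteq> e" "d \<noteq> e"
      "b \<noteq> a" "c \<noteq> a" "d \<noteq> a" "e \<noteq> a" "c \<noteq> b" "d \<noteq> b" "e \<noteq> b" "d \<noteq> c" "e \<noteq> c" "e \<noteq> d"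
    using dist by auto
  have f: "f a = 0" "f b = 1" "f c = 2" "f d = 3" "f e = 4"
    using dist by (auto simp: f_def)
  have "{..<5} = {0, 1, 2, 3, 4::nat}"
    by auto
  then have bij: "bij_betw f {a, b, c, d, e} {..<5}"
    unfolding bij_betw_def inj_on_def by (simp add: f ne)
  have verts: "{a, b, c, d, e} \<subseteq> verts G"
    using assms(1) sub by (auto simp: simple_graph_def)
  have iso: "\<forall>x\<in>{a, b, c, d, e}. \<forall>y\<in>{a, b, c, d, e}.
      {x, y} \<in> {{a, b}, {b, c}, {c, d}, {d, e}, {e, a}} \<longleftrightarrow> {f x, f y} \<in> edges (cycle_graph 5)"
    unfolding edges_cycle_graph_5
    by (simp only: f ball_simps insert_iff ne doubleton_eq_iff) simp
  have simple: "simple_graph ({a, b, c, d, e}, {{a, b}, {b, c}, {c, d}, {d, e}, {e, a}})"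
    by (simp add: simple_graph_def ne)
  have "verts (cycle_graph 5) = {..<5}"
    by (simp add: cycle_graph_def)
  then have "graph_iso ({a, b, c, d, e}, {{a, b}, {b, c}, {c, d}, {d, e}, {e, a}}) (cycle_graph 5)"
    unfolding graph_iso_def fst_conv snd_conv
    by (intro exI[of _ f] conjI iso) (simp only: bij)
  then show ?thesis
    unfolding is_copy_def subgraph_def fst_conv snd_conv using sub verts simple by (simp only: simp_thms)
qed

text \<open>
  A copy of the cycle has no further edges, because an isomorphism also reflects adjacency.
\<close>

lemma five_cycle_of_copy:
  assumes "is_copy (cycle_graph 5) G K"
  shows "edges K \<in> five_cycles G"
proof -
  from assms obtain f where K: "simple_graph K" "edges K \<subseteq> edges G"
    and bij: "bij_betw f (verts K) {..<5::nat}"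
    and adj: "\<And>x y. x \<in> verts K \<Longrightarrow> y \<in> verts K \<Longrightarrow>
      {x, y} \<in> edges K \<longleftrightarrow> {f x, f y} \<in> edges (cycle_graph 5)"
    by (auto simp: is_copy_def subgraph_def graph_iso_def cycle_graph_def)
  define g where "g = inv_into (verts K) f"
  have g: "bij_betw g {..<5} (verts K)"
    unfolding g_def by (rule bij_betw_inv_into[OF bij])
  have fg: "f (g i) = i" if "i < 5" for i
    unfolding g_def using that by (intro bij_betw_inv_into_right[OF bij]) simp
  have gK: "g i \<in> verts K" if "i < 5" for i
    using g that by (auto simp: bij_betw_def)
  have edge: "{g i, g j} \<in> edges K \<longleftrightarrow> {i, j} \<in> edges (cycle_graph 5)" if "i < 5" "j < 5" for i j
    using adj[OF gK gK] fg that by simp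
  have eq: "edges K = {{g 0, g 1}, {g 1, g 2}, {g 2, g 3}, {g 3, g 4}, {g 4, g 0}}" (is "_ = ?S")
  proof (intro equalityI subsetI)
    fix s assume s: "s \<in> edges K"
    then obtain x y where xy: "s = {x, y}" "x \<in> verts K" "y \<in> verts K"
      using K(1) by (auto simp: simple_graph_def card_2_iff)
    then obtain i j where ij: "x = g i" "y = g j" "i < 5" "j < 5"
      using g unfolding bij_betw_def by (metis imageE lessThan_iff)
    then have "{i, j} \<in> edges (cycle_graph 5)"
      using edge s xy by simp
    then have "g ` {i, j} \<in> (`) g ` edges (cycle_graph 5)"
      by (rule imageI)
    then show "s \<in> ?S"
      unfolding edges_cycle_graph_5 xy ij by simp
  next
    fix s assume "s \<in> ?S"
    moreover have "{g 0, g 1} \<in> edges K" "{g 1, g 2} \<in> edges K" "{g 2, g 3} \<in> edges K"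
        "{g 3, g 4} \<in> edges K" "{g 4, g 0} \<in> edges K"
      by (subst edge; simp only: edges_cycle_graph_5; simp)+
    ultimately show "s \<in> edges K"
      by blast
  qed
  have inj: "g i = g j \<longleftrightarrow> i = j" if "i < 5" "j < 5" for i j
    using fg[OF that(1)] fg[OF that(2)] by metis
  have "distinct [g 0, g 1, g 2, g 3, g 4]"
    by (simp add: inj)
  then show ?thesis
    using K(2) unfolding eq by (rule five_cyclesI)
qed

lemma anti_ramsey_five_cycle:
  assumes "simple_graph G"
  shows "anti_ramsey G (cycle_graph 5) = max_colours (edges G) (five_cycles G)"
proof -
  have "(\<exists>K. is_copy (cycle_graph 5) G K \<and> rainbow c K) \<longleftrightarrow> (\<exists>S\<in>five_cycles G. inj_on c S)"
    for c :: "'a set \<Rightarrow> nat"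
  proof
    assume "\<exists>S\<in>five_cycles G. inj_on c S"
    then obtain S where "S \<in> five_cycles G" and rainbow: "inj_on c S"
      by blast
    from this(1) have "\<exists>V. is_copy (cycle_graph 5) G (V, S)"
      by (elim five_cyclesE) (use copy_of_five_cycle[OF assms] in fast)
    then show "\<exists>K. is_copy (cycle_graph 5) G K \<and> rainbow c K"
      using rainbow unfolding rainbow_def by (metis snd_conv)
  next
    assume "\<exists>K. is_copy (cycle_graph 5) G K \<and> rainbow c K"
    then show "\<exists>S\<in>five_cycles G. inj_on c S"
      unfolding rainbow_def by (metis five_cycle_of_copy)
  qed
  then show ?thesis
    unfolding anti_ramsey_def max_colours_def by simp
qed

lemma max_colours_transfer:
  fixes \<sigma> :: "'a \<Rightarrow> 'b"
  assumes "bij_betw \<sigma> E F" and sub: "\<P> \<subseteq> Pow E"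
  shows "max_colours F ((`) \<sigma> ` \<P>) = max_colours E \<P>"
proof -
  define \<tau> where "\<tau> = inv_into E \<sigma>"
  have \<sigma>: "inj_on \<sigma> E" "F = \<sigma> ` E" and \<tau>: "\<And>x. x \<in> E \<Longrightarrow> \<tau> (\<sigma> x) = x"
    using assms(1) by (auto simp: bij_betw_def \<tau>_def)
  have "{card (c ` F) | c :: 'b \<Rightarrow> nat. \<forall>S\<in>(`) \<sigma> ` \<P>. \<not> inj_on c S} =
        {card (c ` E) | c :: 'a \<Rightarrow> nat. \<forall>S\<in>\<P>. \<not> inj_on c S}" (is "?L = ?R")
  proof (intro equalityI subsetI)
    fix m assume "m \<in> ?L"
    then obtain c :: "'b \<Rightarrow> nat" where c: "m = card (c ` F)" "\<forall>S\<in>\<P>. \<not> inj_on c (\<sigma> ` S)"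
      by auto
    have "\<not> inj_on (c \<circ> \<sigma>) S" if "S \<in> \<P>" for S
      using c(2) that inj_on_imageI[of c \<sigma> S] by auto
    moreover have "m = card ((c \<circ> \<sigma>) ` E)"
      using c(1) \<sigma>(2) by (simp add: image_comp)
    ultimately show "m \<in> ?R"
      by blast
  next
    fix m assume "m \<in> ?R"
    then obtain c :: "'a \<Rightarrow> nat" where c: "m = card (c ` E)" "\<forall>S\<in>\<P>. \<not> inj_on c S"
      by auto
    have "\<not> inj_on (c \<circ> \<tau>) (\<sigma> ` S)" if "S \<in> \<P>" for S
    proof
      assume *: "inj_on (c \<circ> \<tau>) (\<sigma> ` S)"
      have "inj_on \<sigma> S"
        using sub that \<sigma>(1) by (auto intro: inj_on_subset)
      then have "inj_on (c \<circ> \<tau> \<circ> \<sigma>) S"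
        using * by (rule comp_inj_on)
      moreover have "\<And>x. x \<in> S \<Longrightarrow> (c \<circ> \<tau> \<circ> \<sigma>) x = c x"
        using sub that \<tau> by (metis PowD comp_apply subset_iff)
      ultimately show False
        using c(2) that by (metis inj_on_cong)
    qed
    moreover have "m = card ((c \<circ> \<tau>) ` F)"
      using c(1) \<sigma>(2) \<tau> by (simp add: image_image)
    ultimately show "m \<in> ?L"
      by blast
  qed
  then show ?thesis
    unfolding max_colours_def by simp
qed

text \<open>
  The lower bound is witnessed by a colouring \<open>r\<close> with colours of any type; below, the colours
  will be edges, each class being named after one of its members.
\<close>

lemma max_colours_eqI:
  fixes r :: "'e \<Rightarrow> 'x"
  assumes "finite E"
    and upper: "\<And>c :: 'e \<Rightarrow> nat. (\<And>S. S \<in> \<P> \<Longrightarrow> \<not> inj_on c S) \<Longrightarrow> card (c ` E) \<le> m"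
    and m: "card (r ` E) = m"
    and not_rainbow: "\<And>S. S \<in> \<P> \<Longrightarrow> \<exists>x\<in>S. \<exists>y\<in>S. x \<noteq> y \<and> r x = r y"
  shows "max_colours E \<P> = m"
proof -
  let ?M = "{card (c ` E) | c :: 'e \<Rightarrow> nat. \<forall>S\<in>\<P>. \<not> inj_on c S}"
  obtain g :: "'x \<Rightarrow> nat" where g: "inj_on g (r ` E)"
    using finite_imp_inj_to_nat_seg[of "r ` E"] assms(1) by blast
  have "\<forall>S\<in>\<P>. \<not> inj_on (g \<circ> r) S"
    using not_rainbow unfolding inj_on_def comp_def by metis
  moreover have "card ((g \<circ> r) ` E) = m"
    using card_image[OF g] m by (simp add: image_comp)
  ultimately have "m \<in> ?M"
    by blast
  moreover have le: "x \<le> m" if "x \<in> ?M" for x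
    using that upper by auto
  moreover have "finite ?M"
    using le by (meson finite_nat_set_iff_bounded_le)
  ultimately show ?thesis
    unfolding max_colours_def by (intro Max_eqI) auto
qed

section \<open>Counting the pentagons spoiled by colour classes\<close>

text \<open>
  The members of the family that are spoiled by a colour class \<open>A\<close>, i.e. not rainbow because
  of two edges in \<open>A\<close>.
\<close>

definition hit :: "'i set \<Rightarrow> ('i \<Rightarrow> 'e set) \<Rightarrow> 'e set \<Rightarrow> 'i set" where
  "hit I C A = {i \<in> I. 2 \<le> card (C i \<inter> A)}"

lemma card_eq_colours_plus_defect:
  assumes "finite E"
  shows "card E = card (c ` E) + (\<Sum>x\<in>c ` E. card {e \<in> E. c e = x} - 1)"
proof -
  have "card E = (\<Sum>x\<in>c ` E. card {e \<in> E. c e = x})"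
    unfolding card_eq_sum by (rule sum.image_gen[OF assms])
  also have "\<dots> = (\<Sum>x\<in>c ` E. 1 + (card {e \<in> E. c e = x} - 1))"
  proof (intro sum.cong refl)
    fix x assume "x \<in> c ` E"
    then have "card {e \<in> E. c e = x} > 0"
      using assms by (auto simp: card_gt_0_iff)
    then show "card {e \<in> E. c e = x} = 1 + (card {e \<in> E. c e = x} - 1)"
      by simp
  qed
  finally show ?thesis
    by (simp only: sum.distrib) simp
qed

lemma non_rainbow_hit:
  assumes "finite E" and C: "\<And>i. i \<in> I \<Longrightarrow> C i \<subseteq> E"
    and c: "\<And>i. i \<in> I \<Longrightarrow> \<not> inj_on c (C i)"
  shows "I \<subseteq> (\<Union>x\<in>c ` E. hit I C {e \<in> E. c e = x})"
proof
  fix i assume i: "i \<in> I"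
  then obtain e f where ef: "e \<in> C i" "f \<in> C i" "e \<noteq> f" "c e = c f"
    using c[OF i] unfolding inj_on_def by blast
  have "finite (C i \<inter> {e' \<in> E. c e' = c e})"
    using assms(1) by simp
  moreover have "{e, f} \<subseteq> C i \<inter> {e' \<in> E. c e' = c e}"
    using ef C[OF i] by auto
  ultimately have "card {e, f} \<le> card (C i \<inter> {e' \<in> E. c e' = c e})"
    by (rule card_mono)
  then have "i \<in> hit I C {e' \<in> E. c e' = c e}"
    using i ef(3) by (simp add: hit_def)
  then show "i \<in> (\<Union>x\<in>c ` E. hit I C {e \<in> E. c e = x})"
    using ef(1) C[OF i] by blast
qed

text \<open>
  The sum of \<open>card A - 1\<close> over the colour classes \<open>A\<close> is the defect, and every member of the
  family is spoiled by some class; so a bound on what one class can spoil, linear in \<open>card A - 1\<close>,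
  adds up to a bound on the number of colours.
\<close>

lemma defect_bound:
  assumes E: "finite E" and I: "finite I" and C: "\<And>i. i \<in> I \<Longrightarrow> C i \<subseteq> E"
    and c: "\<And>i. i \<in> I \<Longrightarrow> \<not> inj_on c (C i)"
    and hits: "\<And>A. A \<subseteq> E \<Longrightarrow> A \<noteq> {} \<Longrightarrow> p * card (hit I C A) \<le> q * (card A - 1)"
  shows "p * card I + q * card (c ` E) \<le> q * card E"
proof -
  have "card I \<le> card (\<Union>x\<in>c ` E. hit I C {e \<in> E. c e = x})"
    using E I by (intro card_mono non_rainbow_hit[OF E C c]) (auto simp: hit_def)
  also have "\<dots> \<le> (\<Sum>x\<in>c ` E. card (hit I C {e \<in> E. c e = x}))"
    using E by (intro card_UN_le) simp
  finally have "p * card I \<le> p * (\<Sum>x\<in>c ` E. card (hit I C {e \<in> E. c e = x}))"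
    by simp
  also have "\<dots> = (\<Sum>x\<in>c ` E. p * card (hit I C {e \<in> E. c e = x}))"
    by (rule sum_distrib_left)
  also have "\<dots> \<le> (\<Sum>x\<in>c ` E. q * (card {e \<in> E. c e = x} - 1))"
    by (intro sum_mono hits) auto
  also have "\<dots> = q * (\<Sum>x\<in>c ` E. card {e \<in> E. c e = x} - 1)"
    by (rule sum_distrib_left[symmetric])
  finally have "p * card I \<le> q * (\<Sum>x\<in>c ` E. card {e \<in> E. c e = x} - 1)" .
  moreover have "q * card E = q * card (c ` E) + q * (\<Sum>x\<in>c ` E. card {e \<in> E. c e = x} - 1)"
    by (simp only: card_eq_colours_plus_defect[OF E, of c] distrib_left)
  ultimately show ?thesis
    by linarith
qed

lemma sum_card_Int_eq_sum_degree:
  assumes "finite I" "finite A"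
  shows "(\<Sum>i\<in>I. card (C i \<inter> A)) = (\<Sum>e\<in>A. card {i \<in> I. e \<in> C i})"
proof -
  have "(\<Sum>i\<in>I. card (C i \<inter> A)) = (\<Sum>i\<in>I. \<Sum>e\<in>A. if e \<in> C i then 1 else 0)"
    using assms(2) by (intro sum.cong refl) (simp add: sum.If_cases Int_commute)
  also have "\<dots> = (\<Sum>e\<in>A. \<Sum>i\<in>I. if e \<in> C i then 1 else 0)"
    by (rule sum.swap)
  also have "\<dots> = (\<Sum>e\<in>A. card {i \<in> I. e \<in> C i})"
    using assms(1) by (intro sum.cong refl) (simp add: sum.If_cases Int_def)
  finally show ?thesis .
qed

text \<open>
  Double counting of incidences between \<open>A\<close> and the family. The members that are met without being
  spoiled are kept in the inequality, because the equality case for the Petersen graph needs to know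
  that there are none.
\<close>

lemma card_hit_degree:
  assumes "finite I" "finite A" and deg: "\<And>e. e \<in> A \<Longrightarrow> card {i \<in> I. e \<in> C i} \<le> d"
  shows "2 * card (hit I C A) + (\<Sum>i\<in>I - hit I C A. card (C i \<inter> A)) \<le> d * card A"
proof -
  have fin: "finite (hit I C A)" and sub: "hit I C A \<subseteq> I"
    using assms(1) by (auto simp: hit_def)
  have "2 * card (hit I C A) = (\<Sum>i\<in>hit I C A. 2)"
    by simp
  also have "\<dots> \<le> (\<Sum>i\<in>hit I C A. card (C i \<inter> A))"
    by (intro sum_mono) (simp add: hit_def)
  finally have "2 * card (hit I C A) + (\<Sum>i\<in>I - hit I C A. card (C i \<inter> A))
      \<le> (\<Sum>i\<in>I. card (C i \<inter> A))"
    using sum.subset_diff[OF sub assms(1), of "\<lambda>i. card (C i \<inter> A)"] by simp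
  also have "\<dots> \<le> (\<Sum>e\<in>A. d)"
    unfolding sum_card_Int_eq_sum_degree[OF assms(1,2)] by (intro sum_mono deg)
  finally show ?thesis
    by (simp add: mult.commute)
qed

lemma card_hit_le_degree:
  assumes "finite I" "finite A" and "\<And>e. e \<in> A \<Longrightarrow> card {i \<in> I. e \<in> C i} \<le> d"
  shows "2 * card (hit I C A) \<le> d * card A"
  using card_hit_degree[OF assms] by linarith

lemma hit_singleton: "hit I C {e} = {}"
proof -
  have "\<not> 2 \<le> card (C i \<inter> {e})" for i
    using card_mono[of "{e}" "C i \<inter> {e}"] by simp
  then show ?thesis
    by (simp add: hit_def)
qed

lemma hit_pair: "e \<noteq> f \<Longrightarrow> hit I C {e, f} \<subseteq> {i \<in> I. e \<in> C i \<and> f \<in> C i}"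
proof
  fix i assume "e \<noteq> f" and i: "i \<in> hit I C {e, f}"
  have "card {e, f} \<le> card (C i \<inter> {e, f})"
    using i \<open>e \<noteq> f\<close> by (simp add: hit_def)
  then have "C i \<inter> {e, f} = {e, f}"
    by (intro card_seteq) auto
  then show "i \<in> {i \<in> I. e \<in> C i \<and> f \<in> C i}"
    using i by (auto simp: hit_def)
qed

lemma card_nonempty_cases:
  assumes "finite A" "A \<noteq> {}"
  obtains e where "A = {e}" | e f where "e \<noteq> f" "A = {e, f}" | "3 \<le> card A"
proof -
  have "card A > 0"
    using assms by (simp add: card_gt_0_iff)
  then consider "card A = 1" | "card A = 2" | "3 \<le> card A"
    by linarith
  then show ?thesis
    using that by cases (auto simp: card_1_singleton_iff card_2_iff)
qed

text \<open>
  A class of $m \ge 2$ edges spoils at most $dm/2 \le d(m-1)$ members.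
\<close>

lemma colours_le_degree:
  assumes E: "finite E" and I: "finite I" and C: "\<And>i. i \<in> I \<Longrightarrow> C i \<subseteq> E"
    and c: "\<And>i. i \<in> I \<Longrightarrow> \<not> inj_on c (C i)"
    and deg: "\<And>e. e \<in> E \<Longrightarrow> card {i \<in> I. e \<in> C i} \<le> d"
  shows "card I + d * card (c ` E) \<le> d * card E"
proof -
  have "1 * card (hit I C A) \<le> d * (card A - 1)" if A: "A \<subseteq> E" "A \<noteq> {}" for A
  proof (cases "\<exists>e. A = {e}")
    case False
    have "finite A"
      using finite_subset[OF A(1) E] .
    then have "2 \<le> card A"
      using A(2) False by (auto elim: card_nonempty_cases)
    then have "d * card A \<le> d * (2 * (card A - 1))"
      by (intro mult_left_mono) auto
    moreover have "2 * card (hit I C A) \<le> d * card A"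
      using A(1) by (intro card_hit_le_degree[OF I \<open>finite A\<close>] deg) blast
    ultimately show ?thesis
      unfolding mult.left_commute[of d 2] by linarith
  qed (auto simp: hit_singleton)
  from defect_bound[OF E I C c this] show ?thesis
    by simp
qed

text \<open>
  The situation of the faces of a cubic polyhedron. Pairs spoil at most one face by \<open>codeg\<close>, and
  $m \ge 3$ edges spoil at most $m \le \frac{3}{2}(m-1)$ faces; the ratio $3/2$ is attained only by
  triples, such as the three edges at a vertex.
\<close>

lemma colours_le_two_faced:
  assumes E: "finite E" and I: "finite I" and C: "\<And>i. i \<in> I \<Longrightarrow> C i \<subseteq> E"
    and c: "\<And>i. i \<in> I \<Longrightarrow> \<not> inj_on c (C i)"
    and deg: "\<And>e. e \<in> E \<Longrightarrow> card {i \<in> I. e \<in> C i} \<le> 2"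
    and codeg: "\<And>e f i j. \<lbrakk>e \<in> E; f \<in> E; e \<noteq> f; i \<in> I; j \<in> I; e \<in> C i; f \<in> C i; e \<in> C j; f \<in> C j\<rbrakk> \<Longrightarrow> i = j"
  shows "2 * card I + 3 * card (c ` E) \<le> 3 * card E"
proof (rule defect_bound[OF E I C c])
  fix A assume A: "A \<subseteq> E" "A \<noteq> {}"
  have fin: "finite A"
    using finite_subset[OF A(1) E] .
  show "2 * card (hit I C A) \<le> 3 * (card A - 1)"
    using fin A(2)
  proof (cases rule: card_nonempty_cases)
    case (2 e f)
    have "i = j" if "i \<in> hit I C A" "j \<in> hit I C A" for i j
    proof (rule codeg[of e f])
      have "i \<in> {i \<in> I. e \<in> C i \<and> f \<in> C i}" "j \<in> {i \<in> I. e \<in> C i \<and> f \<in> C i}"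
        using that hit_pair[OF 2(1), of I C] unfolding 2(2) by blast+
      then show "i \<in> I" "j \<in> I" "e \<in> C i" "f \<in> C i" "e \<in> C j" "f \<in> C j"
        by simp_all
    qed (use A(1) 2 in auto)
    then have "card (hit I C A) \<le> 1"
      using I by (simp add: card_le_Suc0_iff_eq hit_def)
    then show ?thesis
      using 2 by simp
  next
    case 3
    moreover have "2 * card (hit I C A) \<le> 2 * card A"
      using A(1) by (intro card_hit_le_degree[OF I fin] deg) blast
    ultimately show ?thesis
      by linarith
  qed (auto simp: hit_singleton)
qed

text \<open>
  The degree condition bounds what $m \ge 3$ edges spoil by $2m \le 3(m-1)$, and pairs spoil at most
  $2$ by \<open>codeg\<close>; so twelve pentagons require defect at least $4$. If the defect is $4$, all these
  bounds are tight: exactly two classes are not singletons, both have three edges, they spoil six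
  pentagons each and these two sixes are disjoint. Tightness of the double counting means that a
  pentagon not spoiled by a class avoids it altogether. Hence no pentagon meets both classes, and each
  edge of one class has three edges remote from it, against \<open>remote\<close>.
\<close>

lemma colours_le_petersen_type:
  assumes E: "finite E" and I: "finite I" "card I = 12" and C: "\<And>i. i \<in> I \<Longrightarrow> C i \<subseteq> E"
    and c: "\<And>i. i \<in> I \<Longrightarrow> \<not> inj_on c (C i)"
    and deg: "\<And>e. e \<in> E \<Longrightarrow> card {i \<in> I. e \<in> C i} \<le> 4"
    and codeg: "\<And>e f. \<lbrakk>e \<in> E; f \<in> E; e \<noteq> f\<rbrakk> \<Longrightarrow> card {i \<in> I. e \<in> C i \<and> f \<in> C i} \<le> 2"
    and remote: "\<And>e. e \<in> E \<Longrightarrow> card {f \<in> E. f \<noteq> e \<and> (\<forall>i\<in>I. \<not> (e \<in> C i \<and> f \<in> C i))} \<le> 2"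
  shows "card (c ` E) + 5 \<le> card E"
proof (rule ccontr)
  define K where "K x = {e \<in> E. c e = x}" for x
  define H where "H x = hit I C (K x)" for x
  define D where "D x = card (K x) - 1" for x
  have finK: "finite (K x)" and KE: "K x \<subseteq> E" and finH: "finite (H x)" and HI: "H x \<subseteq> I" for x
    using E I by (auto simp: K_def H_def hit_def)
  have neK: "K x \<noteq> {}" if "x \<in> c ` E" for x
    using that by (auto simp: K_def)
  assume "\<not> card (c ` E) + 5 \<le> card E"
  then have sumD: "(\<Sum>x\<in>c ` E. D x) \<le> 4"
    using card_eq_colours_plus_defect[OF E, of c] by (simp add: D_def K_def)
  have cover: "I \<subseteq> (\<Union>x\<in>c ` E. H x)"
    unfolding H_def K_def by (rule non_rainbow_hit[OF E C c])
  have degK: "2 * card (H x) + (\<Sum>i\<in>I - H x. card (C i \<inter> K x)) \<le> 4 * card (K x)" for x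
    unfolding H_def using KE by (intro card_hit_degree I(1) finK deg) blast
  have pair: "card (H x) \<le> 2" if two: "card (K x) = 2" for x
  proof -
    obtain e f where ef: "K x = {e, f}" "e \<noteq> f"
      using two unfolding card_2_iff by blast
    then have "card (H x) \<le> card {i \<in> I. e \<in> C i \<and> f \<in> C i}"
      unfolding H_def ef(1) using I by (intro card_mono hit_pair) auto
    moreover have "card {i \<in> I. e \<in> C i \<and> f \<in> C i} \<le> 2"
      using KE[of x] ef by (intro codeg) auto
    ultimately show ?thesis
      by linarith
  qed
  have hits: "card (H x) \<le> 3 * D x" if "x \<in> c ` E" for x
    using finK neK[OF that]
  proof (cases rule: card_nonempty_cases)
    case 1
    then show ?thesis
      by (simp add: H_def hit_singleton)
  next
    case (2 e f)
    then show ?thesis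
      using pair[of x] by (simp add: D_def)
  next
    case 3
    then show ?thesis
      using degK[of x] by (simp add: D_def)
  qed
  have "12 \<le> (\<Sum>x\<in>c ` E. card (H x))"
  proof -
    have "card I \<le> card (\<Union>x\<in>c ` E. H x)"
      using E finH by (intro card_mono cover) auto
    also have "\<dots> \<le> (\<Sum>x\<in>c ` E. card (H x))"
      using E by (intro card_UN_le) simp
    finally show ?thesis
      by (simp add: I)
  qed
  moreover have "(\<Sum>x\<in>c ` E. card (H x)) \<le> (\<Sum>x\<in>c ` E. 3 * D x)"
    by (intro sum_mono hits)
  moreover have "(\<Sum>x\<in>c ` E. 3 * D x) \<le> 12"
    using sumD by (simp flip: sum_distrib_left)
  ultimately have sum_eq: "(\<Sum>x\<in>c ` E. card (H x)) = (\<Sum>x\<in>c ` E. 3 * D x)"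
    and "(\<Sum>x\<in>c ` E. 3 * D x) = 12"
    by linarith+
  then have D4: "(\<Sum>x\<in>c ` E. D x) = 4"
    by (simp flip: sum_distrib_left)
  have tight: "card (H x) = 3 * D x" if "x \<in> c ` E" for x
  proof (rule ccontr)
    assume "card (H x) \<noteq> 3 * D x"
    then have "card (H x) < 3 * D x"
      using hits[OF that] by simp
    then have "(\<Sum>x\<in>c ` E. card (H x)) < (\<Sum>x\<in>c ` E. 3 * D x)"
      using that hits E by (intro sum_strict_mono_ex1) auto
    then show False
      using sum_eq by simp
  qed
  \<comment> \<open>A class of two edges would have to spoil three pentagons, one of \<open>m \<ge> 4\<close> edges \<open>3 * (m - 1) > 2 * m\<close>.\<close>
  have three: "card (K x) = 3" "D x = 2" "card (H x) = 6" if "x \<in> c ` E" "D x > 0" for x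
  proof -
    have "card (K x) \<noteq> 2"
      using pair[of x] tight[OF that(1)] by (auto simp: D_def)
    then show "card (K x) = 3"
      using degK[of x] tight[OF that(1)] that(2) by (auto simp: D_def)
    then show "D x = 2" "card (H x) = 6"
      using tight[OF that(1)] by (auto simp: D_def)
  qed
  obtain x where x: "x \<in> c ` E" "D x > 0"
    using D4 by (metis gr0I sum.neutral zero_neq_numeral)
  have "(\<Sum>x\<in>c ` E. D x) = D x + (\<Sum>y\<in>c ` E - {x}. D y)"
    using E x(1) by (intro sum.remove) auto
  then have rest: "(\<Sum>y\<in>c ` E - {x}. D y) = 2"
    using D4 three(2)[OF x] by simp
  then obtain y where y: "y \<in> c ` E" "y \<noteq> x" "D y > 0"
    by (metis DiffE gr0I insertI1 sum.neutral zero_neq_numeral)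
  have "(\<Sum>y\<in>c ` E - {x}. D y) = D y + (\<Sum>z\<in>c ` E - {x} - {y}. D z)"
    using E y by (intro sum.remove) auto
  then have "(\<Sum>z\<in>c ` E - {x} - {y}. D z) = 0"
    using rest three(2)[OF y(1,3)] by simp
  then have "D z = 0" if "z \<in> c ` E" "z \<noteq> x" "z \<noteq> y" for z
    using that E by (auto simp: sum_eq_0_iff)
  then have "H z = {}" if "z \<in> c ` E" "z \<noteq> x" "z \<noteq> y" for z
    using tight[OF that(1)] that finH[of z] by simp
  then have "I = H x \<union> H y"
    using cover HI by blast
  then have "card (H x \<inter> H y) = 0"
    using card_Un_Int[OF finH finH, of x y] three(3)[OF x] three(3)[OF y(1,3)] I(2) by simp
  then have disj: "H x \<inter> H y = {}"
    using finH by simp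
  have meets: "i \<in> H z" if "z \<in> c ` E" "D z > 0" "i \<in> I" "e \<in> C i" "e \<in> K z" for i e z
  proof (rule ccontr)
    assume "i \<notin> H z"
    then have "card (C i \<inter> K z) \<le> (\<Sum>i\<in>I - H z. card (C i \<inter> K z))"
      using that(3) I(1) by (intro member_le_sum) auto
    also have "\<dots> = 0"
      using degK[of z] three[OF that(1,2)] by simp
    finally show False
      using that(4,5) finK[of z] by auto
  qed
  obtain e where e: "e \<in> K x"
    using neK[OF x(1)] by blast
  have "K y \<subseteq> {f \<in> E. f \<noteq> e \<and> (\<forall>i\<in>I. \<not> (e \<in> C i \<and> f \<in> C i))}"
  proof
    fix f assume f: "f \<in> K y"
    have "f \<in> E" "f \<noteq> e"
      using f e y(2) by (auto simp: K_def)
    moreover have "\<not> (e \<in> C i \<and> f \<in> C i)" if "i \<in> I" for i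
      using meets[OF x that _ e] meets[OF y(1,3) that _ f] disj by blast
    ultimately show "f \<in> {f \<in> E. f \<noteq> e \<and> (\<forall>i\<in>I. \<not> (e \<in> C i \<and> f \<in> C i))}"
      by simp
  qed
  then have "card (K y) \<le> card {f \<in> E. f \<noteq> e \<and> (\<forall>i\<in>I. \<not> (e \<in> C i \<and> f \<in> C i))}"
    using E by (intro card_mono) simp
  also have "\<dots> \<le> 2"
    using e KE[of x] by (intro remote) blast
  finally show False
    using three(1)[OF y(1,3)] by simp
qed

section \<open>The pentagons of generalized Petersen graphs\<close>

text \<open>
  Edges are referred to by labels, so that two edges can be compared by comparing indices.
\<close>

datatype petersen_edge = Outer nat | Spoke nat | Inner nat

fun ends :: "nat \<Rightarrow> nat \<Rightarrow> petersen_edge \<Rightarrow> petersen_vertex set" where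
  "ends n k (Outer i) = {U i, U ((i + 1) mod n)}"
| "ends n k (Spoke i) = {U i, V i}"
| "ends n k (Inner i) = {V i, V ((i + k) mod n)}"

definition labels :: "nat \<Rightarrow> petersen_edge set" where
  "labels n = Outer ` {..<n} \<union> Spoke ` {..<n} \<union> Inner ` {..<n}"

lemma labels_simps [simp]:
  "Outer i \<in> labels n \<longleftrightarrow> i < n" "Spoke i \<in> labels n \<longleftrightarrow> i < n" "Inner i \<in> labels n \<longleftrightarrow> i < n"
  by (auto simp: labels_def)

lemma finite_labels [simp]: "finite (labels n)"
  by (simp add: labels_def)

lemma card_labels: "card (labels n) = 3 * n"
proof -
  have "card (Outer ` {..<n}) = n" "card (Spoke ` {..<n}) = n" "card (Inner ` {..<n}) = n"
    by (simp_all add: card_image inj_on_def)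
  moreover have "card (labels n) = card (Outer ` {..<n}) + card (Spoke ` {..<n}) + card (Inner ` {..<n})"
    unfolding labels_def by (subst card_Un_disjoint; (subst card_Un_disjoint)?; auto)
  ultimately show ?thesis
    by simp
qed

text \<open>
  The possible pentagons. Those of the last three kinds have two spokes; they are named after the
  run of two edges on one of the rims, which starts at index \<open>i\<close> for an outer run. In the prism
  ($n = 3$, $k = 1$) the inner edge joining the ends of an outer run is traversed the other way round
  than for $k = 2$. An outer edge together with an inner run of length two closes up as
  \<open>u\<^sub>i u\<^sub>i\<^sub>+\<^sub>1 v\<^sub>i\<^sub>+\<^sub>1 v\<^sub>i\<^sub>+\<^sub>1\<^sub>+\<^sub>k v\<^sub>i\<close> when $2k + 1 = n$. In \<open>inner_pentagon g r\<close> the number \<open>g\<close> is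
  $n/5$, and the indices are the residue class of \<open>r\<close> modulo \<open>g\<close>.
\<close>

definition outer_pentagon :: "petersen_edge set" where
  "outer_pentagon = Outer ` {..<5}"

definition inner_pentagon :: "nat \<Rightarrow> nat \<Rightarrow> petersen_edge set" where
  "inner_pentagon g r = (\<lambda>t. Inner (r + t * g)) ` {..<5}"

definition two_outer :: "nat \<Rightarrow> nat \<Rightarrow> petersen_edge set" where
  "two_outer n i = {Outer i, Outer ((i + 1) mod n), Spoke i, Spoke ((i + 2) mod n), Inner i}"

definition prism_two_outer :: "nat \<Rightarrow> petersen_edge set" where
  "prism_two_outer i =
     {Outer i, Outer ((i + 1) mod 3), Spoke i, Spoke ((i + 2) mod 3), Inner ((i + 2) mod 3)}"

definition two_inner :: "nat \<Rightarrow> nat \<Rightarrow> nat \<Rightarrow> petersen_edge set" where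
  "two_inner n k i =
     {Outer i, Spoke i, Spoke ((i + 1) mod n), Inner ((i + 1) mod n), Inner ((i + 1 + k) mod n)}"

definition pentagons :: "nat \<Rightarrow> nat \<Rightarrow> petersen_edge set set" where
  "pentagons n k = {S. S \<subseteq> labels n \<and> ends n k ` S \<in> five_cycles (gen_petersen n k)}"

lemma fifth_or_two_fifths:
  fixes n k :: nat
  assumes "5 * k = n \<or> 5 * k = 2 * n"
  shows "n = 5 * (n div 5)" and "k = n div 5 \<or> k = 2 * (n div 5)"
proof -
  obtain g where "n = 5 * g" "k = g \<or> k = 2 * g"
  proof (cases "5 * k = n")
    case True
    then show ?thesis
      using that[of k] by simp
  next
    case False
    then have "n = 5 * (n - 2 * k)" "k = 2 * (n - 2 * k)"
      using assms by linarith+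
    then show ?thesis
      using that[of "n - 2 * k"] by simp
  qed
  then show "n = 5 * (n div 5)" "k = n div 5 \<or> k = 2 * (n div 5)"
    by simp_all
qed

locale petersen =
  fixes n k :: nat
  assumes n3: "3 \<le> n" and k1: "1 \<le> k" and kn: "2 * k < n"
begin

abbreviation "P \<equiv> gen_petersen n k"

definition step :: "nat \<Rightarrow> nat \<Rightarrow> nat \<Rightarrow> bool" where
  "step s i j \<longleftrightarrow> i < n \<and> j = (i + s) mod n"

lemma shift_eq_imp_eq:
  assumes "i \<le> j" "j < n" "(j + s) mod n = (i + s) mod n"
  shows "i = j"
proof -
  have "n dvd j - i"
    using mod_eq_dvd_iff_nat[of "i + s" "j + s" n] assms by simp
  then show ?thesis
    using assms nat_dvd_not_less[of "j - i" n] by (cases "i = j") auto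
qed

lemma step_lt: "step s i j \<Longrightarrow> i < n \<and> j < n"
  using n3 by (auto simp: step_def)

lemma stepD: "step s i j \<Longrightarrow> (i + s) mod n = j"
  by (simp add: step_def)

lemma step_right_unique: "step s i j \<Longrightarrow> step s i j' \<Longrightarrow> j = j'"
  by (simp add: step_def)

lemma step_left_unique: "step s i j \<Longrightarrow> step s i' j \<Longrightarrow> i = i'"
  unfolding step_def using shift_eq_imp_eq[of i i' s] shift_eq_imp_eq[of i' i s]
  by (metis nat_le_linear)

lemma step_trans: "step s a b \<Longrightarrow> step t b c \<Longrightarrow> step (s + t) a c"
  by (auto simp: step_def mod_simps add.assoc)

lemma step_loop:
  assumes "step s i i"
  shows "n dvd s"
proof -
  have "(i + s) mod n = i mod n"
    using assms by (simp add: step_def)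
  then show ?thesis
    using mod_eq_dvd_iff_nat[of i "i + s" n] by simp
qed

lemma not_step_self: "0 < s \<Longrightarrow> s < n \<Longrightarrow> \<not> step s i i"
  using step_loop nat_dvd_not_less by blast

lemma step_asym: "0 < s \<Longrightarrow> 2 * s < n \<Longrightarrow> step s i j \<Longrightarrow> \<not> step s j i"
  using step_trans[of s i j s i] not_step_self[of "s + s" i] by auto

text \<open>
  A path along one rim cannot turn back, since each vertex has only one successor and one
  predecessor; this is what reduces closed walks to congruences.
\<close>

lemma step_straight:
  assumes "step s a b \<or> step s b a" "step s b c \<or> step s c b" "a \<noteq> c"
  shows "step s a b \<and> step s b c \<or> step s b a \<and> step s c b"
  using assms step_left_unique step_right_unique by blast

lemma edges_P: "edges P = ends n k ` labels n"
  by (simp only: gen_petersen_def snd_conv lessThan_iff[symmetric] Setcompr_eq_image labels_def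
    image_Un image_image ends.simps)

lemma adjacent:
  "{U i, U j} \<in> edges P \<longleftrightarrow> step 1 i j \<or> step 1 j i"
  "{U i, V j} \<in> edges P \<longleftrightarrow> i < n \<and> i = j"
  "{V j, U i} \<in> edges P \<longleftrightarrow> i < n \<and> i = j"
  "{V i, V j} \<in> edges P \<longleftrightarrow> step k i j \<or> step k j i"
  unfolding edges_P labels_def image_Un image_image ends.simps
  by (auto simp: image_iff step_def doubleton_eq_iff)

lemma simple_P: "simple_graph P"
proof -
  have "i \<noteq> (i + 1) mod n" "i \<noteq> (i + k) mod n" if "i < n" for i
    using not_step_self[of 1 i] not_step_self[of k i] n3 k1 kn that by (simp_all add: step_def)
  then show ?thesis
    using n3 by (auto simp: simple_graph_def gen_petersen_def)
qed

lemma step_edge_eq: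
  assumes "0 < s" "2 * s < n" "i < n" "j < n" "{i, (i + s) mod n} = {j, (j + s) mod n}"
  shows "i = j"
  using assms step_asym[of s i j] unfolding doubleton_eq_iff step_def by metis

lemma inj_ends: "inj_on (ends n k) (labels n)"
proof (rule inj_onI)
  fix x y assume xy: "x \<in> labels n" "y \<in> labels n" "ends n k x = ends n k y"
  have U: "U ` A = U ` B \<longleftrightarrow> A = B" and V: "V ` A = V ` B \<longleftrightarrow> A = B" for A B
    by (simp_all add: inj_image_eq_iff inj_def)
  show "x = y"
  proof (cases x; cases y)
    fix i j assume eq: "x = Outer i" "y = Outer j"
    then have "U ` {i, (i + 1) mod n} = U ` {j, (j + 1) mod n}"
      using xy by simp
    then show ?thesis
      using step_edge_eq[of 1 i j] xy n3 unfolding U by (simp add: eq)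
  next
    fix i j assume eq: "x = Inner i" "y = Inner j"
    then have "V ` {i, (i + k) mod n} = V ` {j, (j + k) mod n}"
      using xy by simp
    then show ?thesis
      using step_edge_eq[of k i j] xy k1 kn unfolding V by (simp add: eq)
  qed (use xy in \<open>auto simp: doubleton_eq_iff\<close>)
qed

definition circuit :: "petersen_vertex \<Rightarrow> petersen_vertex \<Rightarrow> petersen_vertex \<Rightarrow> petersen_vertex \<Rightarrow>
    petersen_vertex \<Rightarrow> petersen_vertex set set \<Rightarrow> bool" where
  "circuit a b c d e S \<longleftrightarrow> S = {{a, b}, {b, c}, {c, d}, {d, e}, {e, a}} \<and>
     distinct [a, b, c, d, e] \<and> S \<subseteq> edges P"

lemma circuit_rotate: "circuit a b c d e S \<Longrightarrow> circuit b c d e a S"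
  by (auto simp: circuit_def)

lemma circuit_reflect: "circuit a b c d e S \<Longrightarrow> circuit c b a e d S"
  by (auto simp: circuit_def insert_commute)

lemma no_lone_outer: "\<not> circuit (V a) (U b) (V c) d e S"
  by (auto simp: circuit_def adjacent)

lemma no_lone_inner: "\<not> circuit (U a) (V b) (U c) d e S"
  by (auto simp: circuit_def adjacent)

text \<open>
  A vertex of a pentagon cannot have both its neighbours on the other rim, as it has a single spoke.
  So the vertices of each rim that are used form a run, and after a rotation the pentagon has one of
  the four shapes. Each of the $32$ distributions over the two rims is refuted or identified by one of
  the five rotations.
\<close>

lemma five_cycle_cases:
  assumes "S \<in> five_cycles P"
  obtains (outer) a b c d e where "circuit (U a) (U b) (U c) (U d) (U e) S"
  | (inner) a b c d e where "circuit (V a) (V b) (V c) (V d) (V e) S"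
  | (two_outer) a b c d e where "circuit (U a) (U b) (U c) (V d) (V e) S"
  | (two_inner) a b c d e where "circuit (V a) (V b) (V c) (U d) (U e) S"
proof -
  obtain v w x y z where "S = {{v, w}, {w, x}, {x, y}, {y, z}, {z, v}}" "distinct [v, w, x, y, z]"
    "{{v, w}, {w, x}, {x, y}, {y, z}, {z, v}} \<subseteq> edges P"
    using assms by (rule five_cyclesE)
  then have 1: "circuit v w x y z S"
    unfolding circuit_def by metis
  note 2 = circuit_rotate[OF 1]
  note 3 = circuit_rotate[OF 2]
  note 4 = circuit_rotate[OF 3]
  note 5 = circuit_rotate[OF 4]
  show ?thesis
    using 1 2 3 4 5
    by (cases v; cases w; cases x; cases y; cases z; hypsubst)
      (erule that(1) | erule that(2) | erule that(3) | erule that(4)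
        | erule notE[OF no_lone_outer] | erule notE[OF no_lone_inner])+
qed

lemma circuitD:
  assumes "circuit a b c d e S"
  shows "S = {{a, b}, {b, c}, {c, d}, {d, e}, {e, a}}" "distinct [a, b, c, d, e]"
    "{a, b} \<in> edges P" "{b, c} \<in> edges P" "{c, d} \<in> edges P" "{d, e} \<in> edges P" "{e, a} \<in> edges P"
  using assms unfolding circuit_def by blast+

lemma straight_circuit:
  assumes s: "0 < s" "2 * s < n" and dist: "distinct [a, b, c, d, e]"
    and adj: "step s a b \<or> step s b a" "step s b c \<or> step s c b" "step s c d \<or> step s d c"
      "step s d e \<or> step s e d" "step s e a \<or> step s a e"
  shows "step s a b \<and> step s b c \<and> step s c d \<and> step s d e \<and> step s e a \<or>
    step s b a \<and> step s c b \<and> step s d c \<and> step s e d \<and> step s a e"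
proof -
  have ne: "a \<noteq> c" "b \<noteq> d" "c \<noteq> e" "d \<noteq> a"
    using dist by auto
  have asym: "\<not> (step s i j \<and> step s j i)" for i j
    using step_asym[OF s] by blast
  show ?thesis
    using step_straight[OF adj(1,2) ne(1)] step_straight[OF adj(2,3) ne(2)]
      step_straight[OF adj(3,4) ne(3)] step_straight[OF adj(4,5) ne(4)]
      asym[of b c] asym[of c d] asym[of d e]
    by argo
qed

lemma straight_circuit_dvd:
  assumes "step s a b \<and> step s b c \<and> step s c d \<and> step s d e \<and> step s e a"
  shows "n dvd 5 * s"
proof -
  have "step (s + s + s + s + s) a a"
    using assms by (meson step_trans)
  moreover have "s + s + s + s + s = 5 * s"
    by simp
  ultimately show ?thesis
    using step_loop by simp
qed

lemma straight_circuit_edges: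
  assumes "step s a b \<and> step s b c \<and> step s c d \<and> step s d e \<and> step s e a \<or>
      step s b a \<and> step s c b \<and> step s d c \<and> step s e d \<and> step s a e"
  shows "{{f a, f b}, {f b, f c}, {f c, f d}, {f d, f e}, {f e, f a}} =
    (\<lambda>i. {f i, f ((i + s) mod n)}) ` {a, b, c, d, e}"
  using assms
proof
  assume "step s a b \<and> step s b c \<and> step s c d \<and> step s d e \<and> step s e a"
  then have "(a + s) mod n = b" "(b + s) mod n = c" "(c + s) mod n = d" "(d + s) mod n = e" "(e + s) mod n = a"
    by (simp_all only: stepD)
  then show ?thesis
    by (simp only: image_insert image_empty)
next
  assume "step s b a \<and> step s c b \<and> step s d c \<and> step s e d \<and> step s a e"
  then have "(a + s) mod n = e" "(b + s) mod n = a" "(c + s) mod n = b" "(d + s) mod n = c" "(e + s) mod n = d"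
    by (simp_all only: stepD)
  then have "(\<lambda>i. {f i, f ((i + s) mod n)}) ` {a, b, c, d, e} =
      {{f a, f e}, {f b, f a}, {f c, f b}, {f d, f c}, {f e, f d}}"
    by (simp only: image_insert image_empty)
  also have "\<dots> = {{f a, f b}, {f b, f c}, {f c, f d}, {f d, f e}, {f e, f a}}"
    by (simp only: insert_commute)
  finally show ?thesis ..
qed

lemma outer_circuit:
  assumes C: "circuit (U a) (U b) (U c) (U d) (U e) S"
  shows "n = 5 \<and> S = ends n k ` outer_pentagon"
proof -
  have dist: "distinct [a, b, c, d, e]"
    using circuitD(2)[OF C] by simp
  have walk: "step 1 a b \<and> step 1 b c \<and> step 1 c d \<and> step 1 d e \<and> step 1 e a \<or>
      step 1 b a \<and> step 1 c b \<and> step 1 d c \<and> step 1 e d \<and> step 1 a e"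
    using circuitD(3-7)[OF C] n3 unfolding adjacent by (intro straight_circuit dist) simp_all
  then have "n dvd 5 * 1"
    using straight_circuit_dvd[of 1 a b c d e] straight_circuit_dvd[of 1 a e d c b] by blast
  then have "n dvd 5" by simp
  moreover have "{a, b, c, d, e} \<subseteq> {..<n}"
    using walk step_lt by blast
  moreover from this have "card {a, b, c, d, e} \<le> n"
    using card_mono[of "{..<n}"] by (metis card_lessThan finite_lessThan)
  moreover have card: "card {a, b, c, d, e} = 5"
    using distinct_card[OF dist] by simp
  ultimately have n: "n = 5" and "{a, b, c, d, e} \<subseteq> {..<5}"
    by (auto dest!: dvd_imp_le)
  then have all: "{a, b, c, d, e} = {..<5}"
    using card by (intro card_subset_eq) simp_all
  have "S = (\<lambda>i. {U i, U ((i + 1) mod n)}) ` {a, b, c, d, e}"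
    unfolding circuitD(1)[OF C] by (rule straight_circuit_edges[OF walk])
  then have "S = ends n k ` outer_pentagon"
    unfolding all by (simp only: outer_pentagon_def image_image ends.simps)
  then show ?thesis
    using n by blast
qed

text \<open>
  Five inner steps return to the start, so $n$ divides $5k$, and $2k < n$ leaves $5k = n$ and
  $5k = 2n$. Then $g = n/5$ divides $k$, so the five indices are congruent modulo $g$ and exhaust
  their residue class.
\<close>

lemma inner_circuit:
  assumes C: "circuit (V a) (V b) (V c) (V d) (V e) S"
  shows "(5 * k = n \<or> 5 * k = 2 * n) \<and> (\<exists>r<n div 5. S = ends n k ` inner_pentagon (n div 5) r)"
proof -
  have dist: "distinct [a, b, c, d, e]"
    using circuitD(2)[OF C] by simp
  have walk: "step k a b \<and> step k b c \<and> step k c d \<and> step k d e \<and> step k e a \<or>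
      step k b a \<and> step k c b \<and> step k d c \<and> step k e d \<and> step k a e"
    using circuitD(3-7)[OF C] k1 kn unfolding adjacent by (intro straight_circuit dist) simp_all
  then have "n dvd 5 * k"
    using straight_circuit_dvd[of k a b c d e] straight_circuit_dvd[of k a e d c b] by blast
  then obtain q where q: "5 * k = n * q"
    by (elim dvdE)
  have "0 < q"
    using q k1 by (cases q) auto
  moreover have "q < 3"
  proof (rule ccontr)
    assume "\<not> q < 3"
    then have "n * 3 \<le> n * q"
      by simp
    then show False
      using q kn by linarith
  qed
  ultimately have kq: "5 * k = n \<or> 5 * k = 2 * n"
    using q by (auto simp: less_Suc_eq numeral_eq_Suc)
  define g where "g = n div 5"
  have n: "n = 5 * g" and "k = g \<or> k = 2 * g"
    using fifth_or_two_fifths[OF kq] unfolding g_def .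
  then have "g dvd k" "0 < g"
    using n3 by auto
  have mod_g: "j mod g = i mod g" if "step k i j" for i j
  proof -
    have "j mod g = (i + k) mod g"
      using mod_mod_cancel[of g n "i + k"] stepD[OF that] n by simp
    then show ?thesis
      using \<open>g dvd k\<close> by (elim dvdE) simp
  qed
  define r where "r = a mod g"
  have "r < g"
    using \<open>0 < g\<close> by (simp add: r_def)
  have "\<forall>i\<in>{a, b, c, d, e}. i < n \<and> i mod g = r"
    using walk step_lt mod_g unfolding r_def by (elim disjE conjE) (metis empty_iff insert_iff)+
  moreover have "i \<in> (\<lambda>t. r + t * g) ` {..<5}" if "i < n" "i mod g = r" for i
  proof
    show "i = r + (i div g) * g"
      using that(2) by (metis add.commute div_mult_mod_eq)
    show "i div g \<in> {..<5}"
      using that(1) n \<open>0 < g\<close> by (simp add: less_mult_imp_div_less)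
  qed
  ultimately have "{a, b, c, d, e} \<subseteq> (\<lambda>t. r + t * g) ` {..<5}"
    by blast
  moreover have "card ((\<lambda>t. r + t * g) ` {..<5}) \<le> card {a, b, c, d, e}"
    using card_image_le[of "{..<5}" "\<lambda>t. r + t * g"] distinct_card[OF dist] by simp
  ultimately have all: "{a, b, c, d, e} = (\<lambda>t. r + t * g) ` {..<5}"
    by (intro card_seteq) simp_all
  have "S = (\<lambda>i. {V i, V ((i + k) mod n)}) ` {a, b, c, d, e}"
    unfolding circuitD(1)[OF C] by (rule straight_circuit_edges[OF walk])
  then have "S = ends n k ` inner_pentagon g r"
    unfolding all by (simp only: inner_pentagon_def image_image ends.simps)
  then show ?thesis
    using kq \<open>r < g\<close> unfolding g_def by blast
qed

text \<open>
  The ends of an outer run of length two have indices that differ by $2$, and they are joined by an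
  inner edge, so $k \equiv \pm 2$ modulo $n$.
\<close>

lemma two_outer_circuit:
  assumes C: "circuit (U a) (U b) (U c) (V d) (V e) S"
  shows "(\<exists>i<n. k = 2 \<and> S = ends n k ` two_outer n i) \<or>
    (\<exists>i<n. n = 3 \<and> S = ends n k ` prism_two_outer i)"
proof -
  have directed: ?thesis if C: "circuit (U a) (U b) (U c) (V d) (V e) S" and "step 1 a b" "step 1 b c" for a b c d e
  proof -
    have [simp]: "d = c" "e = a" and "a < n" "c < n"
      using circuitD(5,7)[OF C] unfolding adjacent by simp_all
    have V: "step k c a \<or> step k a c"
      using circuitD(6)[OF C] unfolding adjacent by simp
    have two: "step 2 a c"
      using step_trans[OF that(2,3)] by (simp add: numeral_2_eq_2)
    have b: "(a + 1) mod n = b" and c: "(b + 1) mod n = c" and c2: "(a + 2) mod n = c"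
      using that(2,3) two by (simp_all only: stepD)
    have S: "S = {{U a, U b}, {U b, U c}, {U c, V c}, {V c, V a}, {V a, U a}}"
      using circuitD(1)[OF C] by simp
    from V show ?thesis
    proof
      assume "step k c a"
      then have "n dvd k + 2"
        using step_loop[of "k + 2" c] step_trans[of k c a 2 c] two by simp
      then have "n \<le> k + 2"
        by (auto dest: dvd_imp_le)
      then have n: "n = 3" "k = 1"
        using n3 k1 kn by linarith+
      have "(c + k) mod n = a"
        using \<open>step k c a\<close> by (simp add: step_def)
      then have "S = ends n k ` {Outer a, Outer b, Spoke a, Spoke c, Inner c}"
        unfolding S image_insert image_empty ends.simps b c by (simp only: insert_commute)
      also have "{Outer a, Outer b, Spoke a, Spoke c, Inner c} = prism_two_outer a"
        using b c2 unfolding prism_two_outer_def n by simp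
      finally show ?thesis
        using \<open>a < n\<close> n by blast
    next
      assume "step k a c"
      have "k = 2"
      proof (cases "k \<le> 2")
        case True
        then have "(a + 2) mod n = (a + k) mod n"
          using \<open>step k a c\<close> c2 by (simp add: step_def)
        then have "n dvd 2 - k"
          using mod_eq_dvd_iff_nat[of "a + k" "a + 2" n] True by simp
        then show ?thesis
          using nat_dvd_not_less[of "2 - k" n] True n3 by (cases "k = 2") auto
      next
        case False
        then have "(a + k) mod n = (a + 2) mod n"
          using \<open>step k a c\<close> c2 by (simp add: step_def)
        then have "n dvd k - 2"
          using mod_eq_dvd_iff_nat[of "a + 2" "a + k" n] False by simp
        then show ?thesis
          using nat_dvd_not_less[of "k - 2" n] False kn by auto
      qed
      have "(a + k) mod n = c"
        using \<open>step k a c\<close> by (simp add: step_def)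
      then have "S = ends n k ` {Outer a, Outer b, Spoke a, Spoke c, Inner a}"
        unfolding S image_insert image_empty ends.simps b c by (simp only: insert_commute)
      also have "{Outer a, Outer b, Spoke a, Spoke c, Inner a} = two_outer n a"
        unfolding two_outer_def b c2 ..
      finally show ?thesis
        using \<open>a < n\<close> \<open>k = 2\<close> by blast
    qed
  qed
  have "a \<noteq> c"
    using circuitD(2)[OF C] by simp
  then have "step 1 a b \<and> step 1 b c \<or> step 1 b a \<and> step 1 c b"
    using circuitD(3,4)[OF C] unfolding adjacent by (intro step_straight)
  then show ?thesis
    using directed[OF C] directed[OF circuit_reflect[OF C]] by blast
qed

text \<open>
  The ends of an inner run of length two have indices that differ by $2k$, and they are joined by an
  outer edge, so $2k \equiv \pm 1$ modulo $n$.
\<close>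

lemma two_inner_circuit:
  assumes C: "circuit (V a) (V b) (V c) (U d) (U e) S"
  shows "n = 2 * k + 1 \<and> (\<exists>i<n. S = ends n k ` two_inner n k i)"
proof -
  have directed: ?thesis
    if C: "circuit (V a) (V b) (V c) (U d) (U e) S" and "step k a b" "step k b c" for a b c d e
  proof -
    have [simp]: "d = c" "e = a" and "a < n" "c < n"
      using circuitD(5,7)[OF C] unfolding adjacent by simp_all
    have two: "step (k + k) a c"
      using step_trans[OF that(2,3)] .
    have "step 1 c a \<or> step 1 a c"
      using circuitD(6)[OF C] unfolding adjacent by simp
    moreover have "\<not> step 1 a c"
    proof
      assume "step 1 a c"
      then have "(a + (k + k)) mod n = (a + 1) mod n"
        using two by (simp add: step_def)
      then have "n dvd 2 * k - 1"
        using mod_eq_dvd_iff_nat[of "a + 1" "a + (k + k)" n] k1 by (simp add: mult_2)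
      moreover have "0 < 2 * k - 1" "2 * k - 1 < n"
        using k1 kn by linarith+
      ultimately show False
        using nat_dvd_not_less by blast
    qed
    ultimately have "step 1 c a"
      by blast
    then have "n dvd 2 * k + 1"
      using step_loop[OF step_trans[OF two \<open>step 1 c a\<close>]] by (simp add: mult_2)
    then have n: "n = 2 * k + 1"
      using kn by (auto dest!: dvd_imp_le)
    have a: "(c + 1) mod n = a" and b: "(a + k) mod n = b" and c: "(b + k) mod n = c"
      using \<open>step 1 c a\<close> that(2,3) by (simp_all only: stepD)
    have b2: "b = (c + 1 + k) mod n"
      unfolding b[symmetric] a[symmetric] by (simp add: mod_simps)
    have "S = {{V a, V b}, {V b, V c}, {V c, U c}, {U c, U a}, {U a, V a}}"
      using circuitD(1)[OF C] by simp
    then have "S = ends n k ` {Outer c, Spoke c, Spoke a, Inner a, Inner b}"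
      unfolding image_insert image_empty ends.simps a b c by (simp only: insert_commute)
    also have "{Outer c, Spoke c, Spoke a, Inner a, Inner b} = two_inner n k c"
      unfolding two_inner_def a b2[symmetric] by (rule refl)
    finally show ?thesis
      using n \<open>c < n\<close> by blast
  qed
  have "a \<noteq> c"
    using circuitD(2)[OF C] by simp
  then have "step k a b \<and> step k b c \<or> step k b a \<and> step k c b"
    using circuitD(3,4)[OF C] unfolding adjacent by (intro step_straight)
  then show ?thesis
    using directed[OF C] directed[OF circuit_reflect[OF C]] by blast
qed


lemma pentagonI:
  assumes "T \<subseteq> labels n" "distinct [a, b, c, d, e]"
    and T: "ends n k ` T = {{a, b}, {b, c}, {c, d}, {d, e}, {e, a}}"
  shows "T \<in> pentagons n k"
proof -
  have "ends n k ` T \<subseteq> edges P"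
    unfolding edges_P using assms(1) by (rule image_mono)
  then have "ends n k ` T \<in> five_cycles P"
    using assms(2) unfolding T by (intro five_cyclesI)
  then show ?thesis
    using assms(1) by (simp add: pentagons_def)
qed

lemma outer_pentagon_labels: "n = 5 \<Longrightarrow> outer_pentagon \<subseteq> labels n"
  by (auto simp: outer_pentagon_def)

lemma inner_pentagon_labels:
  assumes "n = 5 * g" "r < g"
  shows "inner_pentagon g r \<subseteq> labels n"
proof -
  have "r + t * g < n" if "t < 5" for t
  proof -
    have "t * g \<le> 4 * g"
      using that by simp
    then show ?thesis
      using assms by linarith
  qed
  then show ?thesis
    by (auto simp: inner_pentagon_def)
qed

lemma two_outer_labels: "i < n \<Longrightarrow> two_outer n i \<subseteq> labels n"
  using n3 by (simp add: two_outer_def)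

lemma prism_two_outer_labels: "n = 3 \<Longrightarrow> i < n \<Longrightarrow> prism_two_outer i \<subseteq> labels n"
  by (simp add: prism_two_outer_def)

lemma two_inner_labels: "i < n \<Longrightarrow> two_inner n k i \<subseteq> labels n"
  using n3 by (simp add: two_inner_def)

lemma image_lessThan_5: "f ` {..<5::nat} = {f 0, f 1, f 2, f 3, f 4}"
proof -
  have "{..<5::nat} = {0, 1, 2, 3, 4}"
    by auto
  then show ?thesis
    by simp
qed

lemma outer_pentagon_in_pentagons:
  assumes "n = 5"
  shows "outer_pentagon \<in> pentagons n k"
proof (rule pentagonI[OF outer_pentagon_labels[OF assms]])
  show "distinct [U 0, U 1, U 2, U 3, U 4]"
    by simp
  show "ends n k ` outer_pentagon = {{U 0, U 1}, {U 1, U 2}, {U 2, U 3}, {U 3, U 4}, {U 4, U 0}}"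
    unfolding outer_pentagon_def image_image image_lessThan_5 using assms by (simp add: numeral_2_eq_2)
qed

lemma inner_pentagon_in_pentagons:
  assumes n: "n = 5 * g" and r: "r < g" and k: "k = g \<or> k = 2 * g"
  shows "inner_pentagon g r \<in> pentagons n k"
proof -
  have T: "ends n k ` inner_pentagon g r =
    {{V r, V ((r + k) mod n)}, {V (r + g), V ((r + g + k) mod n)}, {V (r + 2 * g), V ((r + 2 * g + k) mod n)},
     {V (r + 3 * g), V ((r + 3 * g + k) mod n)}, {V (r + 4 * g), V ((r + 4 * g + k) mod n)}}"
    unfolding inner_pentagon_def image_image image_lessThan_5 by simp
  have m: "(r + t) mod n = r + t" if "t \<le> 4 * g" for t
    using that n r by simp
  have m5: "(r + 5 * g) mod n = r" "(r + 6 * g) mod n = r + g"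
  proof -
    have "(r + n) mod n = r" "(r + g + n) mod n = r + g"
      using m[of 0] m[of g] by simp_all
    moreover have "r + n = r + 5 * g" "r + g + n = r + 6 * g"
      using n by simp_all
    ultimately show "(r + 5 * g) mod n = r" "(r + 6 * g) mod n = r + g"
      by simp_all
  qed
  note mods = m[of g, simplified] m[of "2 * g", simplified] m[of "3 * g", simplified] m[of "4 * g", simplified] m5
  from k show ?thesis
  proof
    assume "k = g"
    have sums: "r + g + g = r + 2 * g" "r + 2 * g + g = r + 3 * g" "r + 3 * g + g = r + 4 * g"
        "r + 4 * g + g = r + 5 * g"
      by simp_all
    have "ends n k ` inner_pentagon g r =
      {{V r, V (r + g)}, {V (r + g), V (r + 2 * g)}, {V (r + 2 * g), V (r + 3 * g)},
       {V (r + 3 * g), V (r + 4 * g)}, {V (r + 4 * g), V r}}"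
      unfolding \<open>k = g\<close> T[unfolded \<open>k = g\<close>] sums by (simp only: mods)
    then show ?thesis
      using r by (intro pentagonI[OF inner_pentagon_labels[OF n r]]) simp_all
  next
    assume "k = 2 * g"
    have sums: "r + g + 2 * g = r + 3 * g" "r + 2 * g + 2 * g = r + 4 * g" "r + 3 * g + 2 * g = r + 5 * g"
        "r + 4 * g + 2 * g = r + 6 * g"
      by simp_all
    have "ends n k ` inner_pentagon g r =
      {{V r, V (r + 2 * g)}, {V (r + g), V (r + 3 * g)}, {V (r + 2 * g), V (r + 4 * g)},
       {V (r + 3 * g), V r}, {V (r + 4 * g), V (r + g)}}"
      unfolding \<open>k = 2 * g\<close> T[unfolded \<open>k = 2 * g\<close>] sums by (simp only: mods)
    then have "ends n k ` inner_pentagon g r =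
      {{V r, V (r + 2 * g)}, {V (r + 2 * g), V (r + 4 * g)}, {V (r + 4 * g), V (r + g)},
       {V (r + g), V (r + 3 * g)}, {V (r + 3 * g), V r}}"
      by (simp only: insert_commute)
    then show ?thesis
      using r by (intro pentagonI[OF inner_pentagon_labels[OF n r]]) simp_all
  qed
qed

lemma two_outer_in_pentagons:
  assumes "k = 2" "i < n"
  shows "two_outer n i \<in> pentagons n k"
proof (rule pentagonI[OF two_outer_labels[OF assms(2)],
      where a = "U i" and b = "U ((i + 1) mod n)" and c = "U ((i + 2) mod n)" and d = "V ((i + 2) mod n)" and e = "V i"])
  have "i \<noteq> (i + 1) mod n" "i \<noteq> (i + 2) mod n"
    using not_step_self[of 1 i] not_step_self[of 2 i] assms n3 kn by (simp_all add: step_def)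
  moreover have "(i + 1) mod n \<noteq> (i + 2) mod n"
    using not_step_self[of 1 "(i + 1) mod n"] n3 by (simp add: step_def mod_simps)
  ultimately show "distinct [U i, U ((i + 1) mod n), U ((i + 2) mod n), V ((i + 2) mod n), V i]"
    by simp
  show "ends n k ` two_outer n i = {{U i, U ((i + 1) mod n)}, {U ((i + 1) mod n), U ((i + 2) mod n)},
      {U ((i + 2) mod n), V ((i + 2) mod n)}, {V ((i + 2) mod n), V i}, {V i, U i}}"
    unfolding two_outer_def image_insert image_empty ends.simps assms(1)
    by (simp add: mod_simps insert_commute)
qed

lemma prism_two_outer_in_pentagons:
  assumes "n = 3" "i < n"
  shows "prism_two_outer i \<in> pentagons n k"
proof (rule pentagonI[OF prism_two_outer_labels[OF assms],
      where a = "U i" and b = "U ((i + 1) mod n)" and c = "U ((i + 2) mod n)" and d = "V ((i + 2) mod n)" and e = "V i"])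
  have k: "k = 1"
    using k1 kn assms by linarith
  have i: "i = 0 \<or> i = 1 \<or> i = 2"
    using assms by linarith
  then show "distinct [U i, U ((i + 1) mod n), U ((i + 2) mod n), V ((i + 2) mod n), V i]"
    using assms by auto
  show "ends n k ` prism_two_outer i = {{U i, U ((i + 1) mod n)}, {U ((i + 1) mod n), U ((i + 2) mod n)},
      {U ((i + 2) mod n), V ((i + 2) mod n)}, {V ((i + 2) mod n), V i}, {V i, U i}}"
  proof -
    have "((i + 1) mod n + 1) mod n = (i + 2) mod n"
      by (simp add: mod_simps)
    moreover have "((i + 2) mod n + k) mod n = i"
      using i assms k by auto
    ultimately show ?thesis
      unfolding prism_two_outer_def image_insert image_empty ends.simps assms(1)[symmetric]
      by (simp only: insert_commute)
  qed
qed

lemma two_inner_in_pentagons: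
  assumes "n = 2 * k + 1" "i < n"
  shows "two_inner n k i \<in> pentagons n k"
proof (rule pentagonI[OF two_inner_labels[OF assms(2)],
      where a = "U i" and b = "U ((i + 1) mod n)" and c = "V ((i + 1) mod n)" and d = "V ((i + 1 + k) mod n)" and e = "V i"])
  have closes: "((i + 1 + k) mod n + k) mod n = i"
  proof -
    have "((i + 1 + k) mod n + k) mod n = (i + n) mod n"
      unfolding mod_add_left_eq by (simp add: assms(1) mult_2 add.assoc)
    then show ?thesis
      using assms(2) by simp
  qed
  have shift: "((i + 1) mod n + k) mod n = (i + 1 + k) mod n"
    by (simp add: mod_simps)
  have "step 1 i ((i + 1) mod n)" "step k ((i + 1) mod n) ((i + 1 + k) mod n)" "step k ((i + 1 + k) mod n) i"
    using assms(2) n3 unfolding step_def closes shift by simp_all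
  then have "i \<noteq> (i + 1) mod n" "(i + 1) mod n \<noteq> (i + 1 + k) mod n" "(i + 1 + k) mod n \<noteq> i"
    using not_step_self[of 1] not_step_self[of k] n3 k1 kn by fastforce+
  then show "distinct [U i, U ((i + 1) mod n), V ((i + 1) mod n), V ((i + 1 + k) mod n), V i]"
    by auto
  show "ends n k ` two_inner n k i = {{U i, U ((i + 1) mod n)}, {U ((i + 1) mod n), V ((i + 1) mod n)},
      {V ((i + 1) mod n), V ((i + 1 + k) mod n)}, {V ((i + 1 + k) mod n), V i}, {V i, U i}}"
    unfolding two_inner_def image_insert image_empty ends.simps
    by (simp only: closes shift insert_commute)
qed

lemma pentagons_iff:
  "S \<in> pentagons n k \<longleftrightarrow> n = 5 \<and> S = outer_pentagon \<or>
    (5 * k = n \<or> 5 * k = 2 * n) \<and> (\<exists>r<n div 5. S = inner_pentagon (n div 5) r) \<or>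
    k = 2 \<and> (\<exists>i<n. S = two_outer n i) \<or> n = 3 \<and> (\<exists>i<n. S = prism_two_outer i) \<or>
    n = 2 * k + 1 \<and> (\<exists>i<n. S = two_inner n k i)" (is "_ \<longleftrightarrow> ?R")
proof -
  have "?R" if "S \<in> pentagons n k"
  proof -
    have S: "S \<subseteq> labels n" "ends n k ` S \<in> five_cycles P"
      using that by (simp_all add: pentagons_def)
    have eq: "S = T" if "T \<subseteq> labels n" "ends n k ` S = ends n k ` T" for T
      using inj_on_image_eq_iff[OF inj_ends S(1) that(1)] that(2) by simp
    from S(2) show ?R
    proof (cases rule: five_cycle_cases)
      case outer
      from outer_circuit[OF this] have n: "n = 5" and "ends n k ` S = ends n k ` outer_pentagon"
        by blast+
      then show ?thesis
        using eq[OF outer_pentagon_labels[OF n]] by blast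
    next
      case inner
      from inner_circuit[OF this] obtain r where r: "5 * k = n \<or> 5 * k = 2 * n" "r < n div 5"
        "ends n k ` S = ends n k ` inner_pentagon (n div 5) r"
        by blast
      then have "S = inner_pentagon (n div 5) r"
        using fifth_or_two_fifths by (intro eq inner_pentagon_labels)
      then show ?thesis
        using r by (intro disjI2[OF disjI1]) blast
    next
      case two_outer
      from two_outer_circuit[OF this] show ?thesis
      proof (elim disjE exE conjE)
        fix i assume i: "i < n" "k = 2" "ends n k ` S = ends n k ` two_outer n i"
        then have "S = two_outer n i"
          by (intro eq two_outer_labels)
        then show ?thesis
          using i by (intro disjI2[OF disjI2[OF disjI1]]) blast
      next
        fix i assume i: "i < n" "n = 3" "ends n k ` S = ends n k ` prism_two_outer i"
        then have "S = prism_two_outer i"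
          by (intro eq prism_two_outer_labels)
        then show ?thesis
          using i by (intro disjI2[OF disjI2[OF disjI2[OF disjI1]]]) blast
      qed
    next
      case two_inner
      from two_inner_circuit[OF this] obtain i where i: "n = 2 * k + 1" "i < n"
        "ends n k ` S = ends n k ` two_inner n k i"
        by blast
      then have "S = two_inner n k i"
        by (intro eq two_inner_labels)
      then show ?thesis
        using i by (intro disjI2) blast
    qed
  qed
  moreover have "S \<in> pentagons n k" if "?R"
    using that
  proof (elim disjE)
    assume "n = 5 \<and> S = outer_pentagon"
    then show ?thesis
      using outer_pentagon_in_pentagons by simp
  next
    assume "(5 * k = n \<or> 5 * k = 2 * n) \<and> (\<exists>r<n div 5. S = inner_pentagon (n div 5) r)"
    then show ?thesis
      using inner_pentagon_in_pentagons[of "n div 5"] fifth_or_two_fifths by blast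
  next
    assume "k = 2 \<and> (\<exists>i<n. S = two_outer n i)"
    then show ?thesis
      using two_outer_in_pentagons by blast
  next
    assume "n = 3 \<and> (\<exists>i<n. S = prism_two_outer i)"
    then show ?thesis
      using prism_two_outer_in_pentagons by blast
  next
    assume "n = 2 * k + 1 \<and> (\<exists>i<n. S = two_inner n k i)"
    then show ?thesis
      using two_inner_in_pentagons by blast
  qed
  ultimately show ?thesis
    by (rule iffI)
qed

text \<open>
  Everything that follows happens on the hypergraph of pentagons.
\<close>

lemma anti_ramsey_eq_max_colours:
  "anti_ramsey P (cycle_graph 5) = max_colours (labels n) (pentagons n k)"
proof -
  have "five_cycles P = (`) (ends n k) ` pentagons n k"
  proof (intro equalityI subsetI)
    fix S assume S: "S \<in> five_cycles P"
    then have "S \<subseteq> ends n k ` labels n"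
      unfolding edges_P[symmetric] by (elim five_cyclesE) simp
    then obtain T where "T \<subseteq> labels n" "S = ends n k ` T"
      by (auto simp: subset_image_iff)
    then show "S \<in> (`) (ends n k) ` pentagons n k"
      using S by (auto simp: pentagons_def)
  qed (auto simp: pentagons_def)
  moreover have "max_colours (edges P) ((`) (ends n k) ` pentagons n k) = max_colours (labels n) (pentagons n k)"
    unfolding edges_P using inj_ends
    by (intro max_colours_transfer) (auto simp: bij_betw_def pentagons_def)
  ultimately show ?thesis
    using anti_ramsey_five_cycle[OF simple_P] by simp
qed

end

section \<open>Incidences between edges and pentagons\<close>

lemma max_colours_empty: "finite E \<Longrightarrow> max_colours E {} = card E"
  by (rule max_colours_eqI[where r = "\<lambda>x. x"]) (simp_all add: card_image_le)

lemma retract_image: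
  assumes "R \<subseteq> E" "\<And>x. x \<in> R \<Longrightarrow> r x \<in> E - R" "\<And>x. x \<in> E - R \<Longrightarrow> r x = x"
  shows "r ` E = E - R"
proof
  show "r ` E \<subseteq> E - R"
    using assms(2,3) by (metis Diff_iff image_subsetI)
  show "E - R \<subseteq> r ` E"
  proof
    fix x assume "x \<in> E - R"
    then show "x \<in> r ` E"
      using assms(3) by (metis DiffD1 image_eqI)
  qed
qed

lemma card_le_2I: "A \<subseteq> {a, b} \<Longrightarrow> card A \<le> 2"
  using card_mono[of "{a, b}" A] by (auto simp: card_insert_if split: if_splits)

lemma two_outer_mem:
  "Outer x \<in> two_outer n i \<longleftrightarrow> x = i \<or> x = (i + 1) mod n"
  "Spoke x \<in> two_outer n i \<longleftrightarrow> x = i \<or> x = (i + 2) mod n"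
  "Inner x \<in> two_outer n i \<longleftrightarrow> x = i"
  by (auto simp: two_outer_def)

lemma shift_back:
  fixes i n s x :: nat
  assumes "i < n" "s \<le> n" "x = (i + s) mod n"
  shows "i = (x + (n - s)) mod n"
proof -
  have "(x + (n - s)) mod n = (i + n) mod n"
    unfolding assms(3) using mod_add_left_eq[of "i + s" n "n - s"] assms(2) by simp
  then show ?thesis
    using assms(1) by simp
qed

lemma two_outer_degree:
  assumes "2 \<le> n"
  shows "card {i \<in> {..<n}. e \<in> two_outer n i} \<le> 2"
proof (cases e)
  case (Outer x)
  have "{i \<in> {..<n}. e \<in> two_outer n i} \<subseteq> {x, (x + (n - 1)) mod n}"
    using shift_back[of _ n 1 x] assms by (auto simp: Outer two_outer_mem)
  then show ?thesis
    by (rule card_le_2I)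
next
  case (Spoke x)
  have "{i \<in> {..<n}. e \<in> two_outer n i} \<subseteq> {x, (x + (n - 2)) mod n}"
    using shift_back[of _ n 2 x] assms by (auto simp: Spoke two_outer_mem)
  then show ?thesis
    by (rule card_le_2I)
next
  case (Inner x)
  have "{i \<in> {..<n}. e \<in> two_outer n i} \<subseteq> {x, x}"
    by (auto simp: Inner two_outer_mem)
  then show ?thesis
    by (rule card_le_2I)
qed

text \<open>
  For $n \ge 5$ two edges determine the pentagon with two outer edges that contains both. Two
  pentagons \<open>two_outer n i\<close> and \<open>two_outer n j\<close> with a common outer edge have $j - i \equiv \pm 1$, those
  with a common spoke have $j - i \equiv \pm 2$, and the two are incompatible since neither $1$ nor $3$
  vanishes modulo $n$.
\<close>

context petersen
begin

lemma two_outer_common_Outer: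
  assumes "i < n" "j < n" "Outer x \<in> two_outer n i" "Outer x \<in> two_outer n j"
  shows "i = j \<or> step 1 i j \<or> step 1 j i"
  using assms step_left_unique[of 1 i x j] unfolding two_outer_mem step_def by blast

lemma two_outer_common_Spoke:
  assumes "i < n" "j < n" "Spoke x \<in> two_outer n i" "Spoke x \<in> two_outer n j"
  shows "i = j \<or> step 2 i j \<or> step 2 j i"
  using assms step_left_unique[of 2 i x j] unfolding two_outer_mem step_def by blast

lemma not_step_1_2:
  assumes "5 \<le> n" "step 1 i j \<or> step 1 j i" "step 2 i j \<or> step 2 j i"
  shows False
proof -
  have False if "step 1 i j" "step 2 i j \<or> step 2 j i" for i j
    using that(2)
  proof
    assume "step 2 i j"
    then have "j = (i + 1 + 1) mod n"
      by (simp add: step_def)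
    also have "\<dots> = ((i + 1) mod n + 1) mod n"
      by (rule mod_add_left_eq[symmetric])
    also have "(i + 1) mod n = j"
      using that(1) by (rule stepD)
    finally have "step 1 j j"
      using step_lt[OF that(1)] by (simp add: step_def)
    then show False
      using not_step_self[of 1 j] n3 by simp
  next
    assume "step 2 j i"
    then show False
      using step_trans[OF that(1)] not_step_self[of "1 + 2" i] assms(1) by fastforce
  qed
  then show False
    using assms(2,3) by blast
qed

lemma two_outer_codegree:
  assumes n5: "5 \<le> n" and "e \<noteq> f" and ij: "i < n" "j < n"
    and e: "e \<in> two_outer n i" "e \<in> two_outer n j" and f: "f \<in> two_outer n i" "f \<in> two_outer n j"
  shows "i = j"
proof (cases e; cases f)
  fix x y assume eq: "e = Outer x" "f = Outer y"
  then have "{i, (i + 1) mod n} = {j, (j + 1) mod n}"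
    using e f \<open>e \<noteq> f\<close> by (auto simp: two_outer_mem)
  then show "i = j"
    using step_edge_eq[of 1 i j] n5 ij by simp
next
  fix x y assume eq: "e = Spoke x" "f = Spoke y"
  then have "{i, (i + 2) mod n} = {j, (j + 2) mod n}"
    using e f \<open>e \<noteq> f\<close> by (auto simp: two_outer_mem)
  then show "i = j"
    using step_edge_eq[of 2 i j] n5 ij by simp
next
  fix x y assume eq: "e = Outer x" "f = Spoke y"
  show "i = j"
    using two_outer_common_Outer[OF ij] two_outer_common_Spoke[OF ij] not_step_1_2[OF n5] e f
    unfolding eq by blast
next
  fix x y assume eq: "e = Spoke x" "f = Outer y"
  show "i = j"
    using two_outer_common_Outer[OF ij] two_outer_common_Spoke[OF ij] not_step_1_2[OF n5] e f
    unfolding eq by blast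
qed (use e f in \<open>simp_all add: two_outer_mem\<close>)

end

lemma mod_inverse_2:
  fixes i j n :: nat
  assumes "odd n" "i < n" "j < n" "(2 * i) mod n = (2 * j) mod n"
  shows "i = j"
proof -
  have "a = b" if "a \<le> b" "b < n" "(2 * b) mod n = (2 * a) mod n" for a b :: nat
  proof -
    have "n dvd 2 * b - 2 * a"
      using mod_eq_dvd_iff_nat[of "2 * a" "2 * b" n] that by simp
    then have "n dvd 2 * (b - a)"
      by (simp add: right_diff_distrib')
    then have "n dvd b - a"
      using assms(1) coprime_dvd_mult_right_iff[of n 2] by (simp add: coprime_commute)
    then show ?thesis
      using that nat_dvd_not_less[of "b - a" n] by (cases "a = b") auto
  qed
  then show ?thesis
    using assms by (metis nat_le_linear)
qed

text \<open>
  For $n = 2k + 1$, multiplication of the indices by $2$ turns the inner steps into outer steps in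
  the opposite direction, as $2k \equiv -1$. So \<open>u\<^sub>i \<mapsto> v\<^sub>2\<^sub>i\<close>, \<open>v\<^sub>i \<mapsto> u\<^sub>2\<^sub>i\<close> is an isomorphism onto the
  graph with $k = 2$, and this is its action on the edges; adding $n - 1$ is subtracting $1$ modulo
  $n$.
\<close>

fun relabel :: "nat \<Rightarrow> petersen_edge \<Rightarrow> petersen_edge" where
  "relabel n (Outer i) = Inner ((2 * i) mod n)"
| "relabel n (Spoke i) = Spoke ((2 * i) mod n)"
| "relabel n (Inner i) = Outer ((2 * i + (n - 1)) mod n)"

lemma bij_relabel:
  assumes "odd n"
  shows "bij_betw (relabel n) (labels n) (labels n)"
proof -
  have n: "0 < n"
    using assms by (cases n) auto
  have "inj_on (relabel n) (labels n)"
  proof (rule inj_onI)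
    fix x y assume xy: "x \<in> labels n" "y \<in> labels n" "relabel n x = relabel n y"
    show "x = y"
    proof (cases x; cases y)
      fix i j assume eq: "x = Inner i" "y = Inner j"
      then have "(2 * i + (n - 1)) mod n = (2 * j + (n - 1)) mod n"
        using xy by simp
      then have "(2 * i + (n - 1) + 1) mod n = (2 * j + (n - 1) + 1) mod n"
        by (rule mod_add_cong) (rule refl)
      moreover have "2 * m + (n - 1) + 1 = 2 * m + n" for m
        using n by simp
      ultimately have double: "(2 * i) mod n = (2 * j) mod n"
        by (simp only: mod_add_self2)
      have "i < n" "j < n"
        using xy(1,2) by (simp_all add: eq)
      from mod_inverse_2[OF assms this double] have "i = j" .
      then show ?thesis
        by (simp add: eq)
    qed (use xy in \<open>auto dest: mod_inverse_2[OF assms, rotated 2]\<close>)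
  qed
  moreover have "relabel n ` labels n \<subseteq> labels n"
  proof
    fix y assume "y \<in> relabel n ` labels n"
    then obtain x where "y = relabel n x"
      by blast
    then show "y \<in> labels n"
      using n by (cases x) simp_all
  qed
  ultimately show ?thesis
    by (simp add: bij_betw_def endo_inj_surj)
qed

lemma relabel_two_inner:
  assumes "n = 2 * k + 1"
  shows "relabel n ` two_inner n k i = two_outer n ((2 * i) mod n)"
proof -
  have "(2 * ((i + 1) mod n)) mod n = (2 * i mod n + 2) mod n"
    by (simp add: mod_simps)
  moreover have "(2 * ((i + 1) mod n) + (n - 1)) mod n = (2 * i mod n + 1) mod n"
  proof -
    have "(2 * ((i + 1) mod n) + (n - 1)) mod n = (2 * (i + 1) + (n - 1)) mod n"
      by (metis mod_add_left_eq mod_mult_right_eq)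
    also have "2 * (i + 1) + (n - 1) = 2 * i + 1 + n"
      using assms by simp
    finally show ?thesis
      by (simp only: mod_add_self2 mod_add_left_eq)
  qed
  moreover have "(2 * ((i + 1 + k) mod n) + (n - 1)) mod n = (2 * i) mod n"
  proof -
    have "(2 * ((i + 1 + k) mod n) + (n - 1)) mod n = (2 * (i + 1 + k) + (n - 1)) mod n"
      by (metis mod_add_left_eq mod_mult_right_eq)
    also have "2 * (i + 1 + k) + (n - 1) = 2 * i + n + n"
      using assms by simp
    finally show ?thesis
      by simp
  qed
  ultimately show ?thesis
    unfolding two_inner_def two_outer_def image_insert image_empty relabel.simps
    by (simp only: insert_commute)
qed

lemma inner_pentagon_mem:
  assumes "r < g"
  shows "e \<in> inner_pentagon g r \<longleftrightarrow> (\<exists>x<5 * g. e = Inner x \<and> x mod g = r)"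
proof
  assume "e \<in> inner_pentagon g r"
  then obtain t where t: "t < 5" "e = Inner (r + t * g)"
    by (auto simp: inner_pentagon_def)
  have "r + t * g < 5 * g"
  proof -
    have "t * g \<le> 4 * g"
      using t(1) by simp
    then show ?thesis
      using assms by linarith
  qed
  then show "\<exists>x<5 * g. e = Inner x \<and> x mod g = r"
    using t(2) assms by (intro exI[of _ "r + t * g"]) simp
next
  assume "\<exists>x<5 * g. e = Inner x \<and> x mod g = r"
  then obtain x where x: "x < 5 * g" "e = Inner x" "x mod g = r"
    by blast
  have "e = Inner (r + (x div g) * g)"
    using x(2,3) by (metis add.commute div_mult_mod_eq)
  moreover have "x div g < 5"
    using x(1) by (simp add: less_mult_imp_div_less)
  ultimately show "e \<in> inner_pentagon g r"
    unfolding inner_pentagon_def by blast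
qed

section \<open>Prisms, the Petersen graph and the dodecahedron\<close>

text \<open>
  In a composition of merges of disjoint lists, each list becomes a colour class named after its
  first member.
\<close>

definition merge :: "'a list \<Rightarrow> 'a \<Rightarrow> 'a" where
  "merge A e = (if e \<in> set A then hd A else e)"

definition labels_list :: "nat \<Rightarrow> petersen_edge list" where
  "labels_list n = map Outer [0..<n] @ map Spoke [0..<n] @ map Inner [0..<n]"

lemma set_labels_list: "set (labels_list n) = labels n"
  by (auto simp: labels_list_def labels_def)

text \<open>
  In the graphs with $n \in \{3, 5\}$ and in the dodecahedron the pentagons are listed, so that
  the finitely many incidences can be verified by rewriting.
\<close>

definition two_outer_list :: "nat \<Rightarrow> nat \<Rightarrow> petersen_edge list" where
  "two_outer_list n i = [Outer i, Outer ((i + 1) mod n), Spoke i, Spoke ((i + 2) mod n), Inner i]"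

definition two_inner_list :: "nat \<Rightarrow> nat \<Rightarrow> nat \<Rightarrow> petersen_edge list" where
  "two_inner_list n k i =
     [Outer i, Spoke i, Spoke ((i + 1) mod n), Inner ((i + 1) mod n), Inner ((i + 1 + k) mod n)]"

definition prism_two_outer_list :: "nat \<Rightarrow> petersen_edge list" where
  "prism_two_outer_list i =
     [Outer i, Outer ((i + 1) mod 3), Spoke i, Spoke ((i + 2) mod 3), Inner ((i + 2) mod 3)]"

definition inner_pentagon_list :: "nat \<Rightarrow> nat \<Rightarrow> petersen_edge list" where
  "inner_pentagon_list g r = map (\<lambda>t. Inner (r + t * g)) [0..<5]"

definition outer_pentagon_list :: "petersen_edge list" where
  "outer_pentagon_list = map Outer [0..<5]"

lemma set_pentagon_lists:
  "set (two_outer_list n i) = two_outer n i"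
  "set (two_inner_list n k i) = two_inner n k i"
  "set (prism_two_outer_list i) = prism_two_outer i"
  "set (inner_pentagon_list g r) = inner_pentagon g r"
  "set outer_pentagon_list = outer_pentagon"
  by (simp_all add: two_outer_list_def two_outer_def two_inner_list_def two_inner_def
    prism_two_outer_list_def prism_two_outer_def inner_pentagon_list_def inner_pentagon_def
    outer_pentagon_list_def outer_pentagon_def atLeast0LessThan)

lemma card_indices: "card {i \<in> {..<length Cs}. P (Cs ! i)} = length (filter P Cs)"
  by (simp add: length_filter_conv_card)

lemma bex_set_conv_nth: "(\<exists>S\<in>set Cs. Q S) \<longleftrightarrow> (\<exists>i\<in>{..<length Cs}. Q (Cs ! i))"
  by (metis in_set_conv_nth lessThan_iff)

lemma not_rainbow_by_lists:
  assumes "list_all (\<lambda>S. list_ex (\<lambda>x. list_ex (\<lambda>y. x \<noteq> y \<and> r x = r y) S) S) Cs" "S \<in> set ` set Cs"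
  shows "\<exists>x\<in>S. \<exists>y\<in>S. x \<noteq> y \<and> r x = r y"
  using assms by (auto simp: list_all_iff list_ex_iff)

lemma card_image_set: "card (r ` set L) = length (remdups (map r L))"
  by (metis list.set_map length_remdups_card_conv)

definition prism_pentagons :: "petersen_edge list list" where
  "prism_pentagons = map prism_two_outer_list [0..<3] @ map (two_inner_list 3 1) [0..<3]"

definition petersen_pentagons :: "petersen_edge list list" where
  "petersen_pentagons = map (two_outer_list 5) [0..<5] @ map (two_inner_list 5 2) [0..<5] @
     [outer_pentagon_list, inner_pentagon_list 1 0]"

definition dodecahedron_pentagons :: "petersen_edge list list" where
  "dodecahedron_pentagons = map (two_outer_list 10) [0..<10] @ map (inner_pentagon_list 2) [0..<2]"

lemma pentagons_3_1: "pentagons 3 1 = set ` set prism_pentagons"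
proof -
  interpret petersen 3 1
    by unfold_locales simp_all
  have "set ` set prism_pentagons = prism_two_outer ` {..<3} \<union> two_inner 3 1 ` {..<3}"
    unfolding prism_pentagons_def set_append set_map image_Un image_image set_upt
      set_pentagon_lists atLeast0LessThan ..
  then show ?thesis
    by (simp only: set_eq_iff[of "pentagons 3 1"] pentagons_iff) auto
qed

lemma pentagons_5_1: "pentagons 5 1 = {outer_pentagon, inner_pentagon 1 0}"
proof -
  interpret petersen 5 1
    by unfold_locales simp_all
  show ?thesis
    by (simp only: set_eq_iff[of "pentagons 5 1"] pentagons_iff) auto
qed

lemma pentagons_5_2: "pentagons 5 2 = set ` set petersen_pentagons"
proof -
  interpret petersen 5 2
    by unfold_locales simp_all
  have "set ` set petersen_pentagons =
      two_outer 5 ` {..<5} \<union> (two_inner 5 2 ` {..<5} \<union> {outer_pentagon, inner_pentagon 1 0})"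
    unfolding petersen_pentagons_def set_append set_map image_Un image_image set_upt
      list.set image_insert image_empty set_pentagon_lists atLeast0LessThan ..
  then show ?thesis
    by (simp only: set_eq_iff[of "pentagons 5 2"] pentagons_iff) auto
qed

lemma pentagons_10_2: "pentagons 10 2 = set ` set dodecahedron_pentagons"
proof -
  interpret petersen 10 2
    by unfold_locales simp_all
  have "set ` set dodecahedron_pentagons = two_outer 10 ` {..<10} \<union> inner_pentagon 2 ` {..<2}"
    unfolding dodecahedron_pentagons_def set_append set_map image_Un image_image set_upt
      set_pentagon_lists atLeast0LessThan ..
  then show ?thesis
    by (simp only: set_eq_iff[of "pentagons 10 2"] pentagons_iff) auto
qed

lemma listed_pentagons:
  assumes "\<P> = set ` set Cs" "\<P> \<subseteq> Pow E" "\<And>S. S \<in> \<P> \<Longrightarrow> \<not> inj_on c S"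
    and "i \<in> {..<length Cs}"
  shows "set (Cs ! i) \<subseteq> E" "\<not> inj_on c (set (Cs ! i))"
proof -
  have "set (Cs ! i) \<in> \<P>"
    using assms(1,4) by simp
  then show "set (Cs ! i) \<subseteq> E" "\<not> inj_on c (set (Cs ! i))"
    using assms(2,3) by auto
qed

lemma pentagons_labels: "pentagons n k \<subseteq> Pow (labels n)"
  by (auto simp: pentagons_def)

text \<open>
  A pentagon of the prism over a triangle has two of the three spokes, so these form a suitable
  colour class.
\<close>

lemma max_colours_3_1: "max_colours (labels 3) (pentagons 3 1) = 7"
proof (rule max_colours_eqI)
  let ?r = "merge [Spoke 0, Spoke 1, Spoke 2]"
  have "length (remdups (map ?r (labels_list 3))) = 7"
    by code_simp
  then show "card (?r ` labels 3) = 7"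
    by (simp only: card_image_set flip: set_labels_list)
  have hit: "list_all (\<lambda>S. list_ex (\<lambda>x. list_ex (\<lambda>y. x \<noteq> y \<and> ?r x = ?r y) S) S) prism_pentagons"
    by code_simp
  show "\<exists>x\<in>S. \<exists>y\<in>S. x \<noteq> y \<and> ?r x = ?r y" if "S \<in> pentagons 3 1" for S
    using not_rainbow_by_lists[OF hit] that unfolding pentagons_3_1 .
next
  fix c :: "petersen_edge \<Rightarrow> nat"
  assume c: "\<And>S. S \<in> pentagons 3 1 \<Longrightarrow> \<not> inj_on c S"
  have len: "length prism_pentagons = 6"
    by code_simp
  have "list_all (\<lambda>e. length (filter (\<lambda>S. e \<in> set S) prism_pentagons) \<le> 4) (labels_list 3)"
    by code_simp
  then have "card {i \<in> {..<length prism_pentagons}. e \<in> set (prism_pentagons ! i)} \<le> 4" if "e \<in> labels 3" for e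
    unfolding card_indices[of _ "\<lambda>S. e \<in> set S"] using that by (simp add: list_all_iff flip: set_labels_list)
  then have "card {..<length prism_pentagons} + 4 * card (c ` labels 3) \<le> 4 * card (labels 3)"
    using listed_pentagons[OF pentagons_3_1 pentagons_labels c]
    by (intro colours_le_degree[where C = "\<lambda>i. set (prism_pentagons ! i)"]) simp_all
  then show "card (c ` labels 3) \<le> 7"
    by (simp add: card_labels len)
qed simp

text \<open>
  The dodecahedron: the four stars at \<open>v\<^sub>0\<close>, \<open>v\<^sub>1\<close>, \<open>u\<^sub>4\<close> and \<open>u\<^sub>7\<close> are colour classes that
  distribute the twelve faces among themselves, three around each of these vertices.
\<close>

lemma max_colours_10_2: "max_colours (labels 10) (pentagons 10 2) = 22"
proof (rule max_colours_eqI)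
  let ?r = "merge [Inner 0, Spoke 0, Inner 8] \<circ> merge [Inner 1, Spoke 1, Inner 9] \<circ>
    merge [Outer 3, Outer 4, Spoke 4] \<circ> merge [Outer 6, Outer 7, Spoke 7]"
  have "length (remdups (map ?r (labels_list 10))) = 22"
    by code_simp
  then show "card (?r ` labels 10) = 22"
    by (simp only: card_image_set flip: set_labels_list)
  have hit: "list_all (\<lambda>S. list_ex (\<lambda>x. list_ex (\<lambda>y. x \<noteq> y \<and> ?r x = ?r y) S) S) dodecahedron_pentagons"
    by code_simp
  show "\<exists>x\<in>S. \<exists>y\<in>S. x \<noteq> y \<and> ?r x = ?r y" if "S \<in> pentagons 10 2" for S
    using not_rainbow_by_lists[OF hit] that unfolding pentagons_10_2 .
next
  fix c :: "petersen_edge \<Rightarrow> nat"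
  let ?C = "\<lambda>i. set (dodecahedron_pentagons ! i)"
  assume c: "\<And>S. S \<in> pentagons 10 2 \<Longrightarrow> \<not> inj_on c S"
  have len: "length dodecahedron_pentagons = 12"
    by code_simp
  have "list_all (\<lambda>e. length (filter (\<lambda>S. e \<in> set S) dodecahedron_pentagons) \<le> 2) (labels_list 10)"
    by code_simp
  then have deg: "card {i \<in> {..<length dodecahedron_pentagons}. e \<in> ?C i} \<le> 2" if "e \<in> labels 10" for e
    unfolding card_indices[of _ "\<lambda>S. e \<in> set S"] using that by (simp add: list_all_iff flip: set_labels_list)
  have "list_all (\<lambda>i. list_all (\<lambda>j. i = j \<or>
      length (filter (\<lambda>e. e \<in> set (dodecahedron_pentagons ! j)) (dodecahedron_pentagons ! i)) \<le> 1) [0..<12]) [0..<12]"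
    by code_simp
  then have meet: "length (filter (\<lambda>e. e \<in> ?C j) (dodecahedron_pentagons ! i)) \<le> 1"
    if "i \<noteq> j" "i < 12" "j < 12" for i j
    using that unfolding list_all_iff set_upt by fastforce
  have codeg: "i = j" if "e \<noteq> f" "i < 12" "j < 12" "e \<in> ?C i" "f \<in> ?C i" "e \<in> ?C j" "f \<in> ?C j" for e f i j
  proof (rule ccontr)
    assume "i \<noteq> j"
    have "card {e, f} \<le> card (set (filter (\<lambda>e. e \<in> ?C j) (dodecahedron_pentagons ! i)))"
      using that by (intro card_mono) auto
    also have "\<dots> \<le> 1"
      using card_length meet[OF \<open>i \<noteq> j\<close> that(2,3)] by (rule le_trans)
    finally show False
      using \<open>e \<noteq> f\<close> by simp
  qed
  have "2 * card {..<length dodecahedron_pentagons} + 3 * card (c ` labels 10) \<le> 3 * card (labels 10)"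
    using listed_pentagons[OF pentagons_10_2 pentagons_labels c] codeg deg
    by (intro colours_le_two_faced[where C = ?C]) (simp_all add: len)
  then show "card (c ` labels 10) \<le> 22"
    by (simp add: card_labels len)
qed simp

text \<open>
  The Petersen graph: the colour class consists of the six edges leaving the closed neighbourhood
  \<open>{v\<^sub>0, u\<^sub>0, v\<^sub>2, v\<^sub>3}\<close> of \<open>v\<^sub>0\<close>. A pentagon is contained neither in this star nor in its complement,
  which is a hexagon, so it crosses the cut at least twice.
\<close>

lemma max_colours_5_2: "max_colours (labels 5) (pentagons 5 2) = 10"
proof (rule max_colours_eqI)
  let ?r = "merge [Outer 0, Outer 4, Spoke 2, Spoke 3, Inner 1, Inner 2]"
  have "length (remdups (map ?r (labels_list 5))) = 10"
    by code_simp
  then show "card (?r ` labels 5) = 10"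
    by (simp only: card_image_set flip: set_labels_list)
  have hit: "list_all (\<lambda>S. list_ex (\<lambda>x. list_ex (\<lambda>y. x \<noteq> y \<and> ?r x = ?r y) S) S) petersen_pentagons"
    by code_simp
  show "\<exists>x\<in>S. \<exists>y\<in>S. x \<noteq> y \<and> ?r x = ?r y" if "S \<in> pentagons 5 2" for S
    using not_rainbow_by_lists[OF hit] that unfolding pentagons_5_2 .
next
  fix c :: "petersen_edge \<Rightarrow> nat"
  let ?C = "\<lambda>i. set (petersen_pentagons ! i)"
  assume c: "\<And>S. S \<in> pentagons 5 2 \<Longrightarrow> \<not> inj_on c S"
  have len: "length petersen_pentagons = 12"
    by code_simp
  have "list_all (\<lambda>e. length (filter (\<lambda>S. e \<in> set S) petersen_pentagons) \<le> 4) (labels_list 5)"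
    by code_simp
  then have deg: "card {i \<in> {..<length petersen_pentagons}. e \<in> ?C i} \<le> 4" if "e \<in> labels 5" for e
    unfolding card_indices[of _ "\<lambda>S. e \<in> set S"] using that by (simp add: list_all_iff flip: set_labels_list)
  have "list_all (\<lambda>e. list_all (\<lambda>f. e = f \<or>
      length (filter (\<lambda>S. e \<in> set S \<and> f \<in> set S) petersen_pentagons) \<le> 2) (labels_list 5)) (labels_list 5)"
    by code_simp
  then have codeg: "card {i \<in> {..<length petersen_pentagons}. e \<in> ?C i \<and> f \<in> ?C i} \<le> 2"
    if "e \<in> labels 5" "f \<in> labels 5" "e \<noteq> f" for e f
    unfolding card_indices[of _ "\<lambda>S. e \<in> set S \<and> f \<in> set S"] using that
    by (auto simp: list_all_iff simp flip: set_labels_list)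
  have few: "list_all (\<lambda>e. length (filter (\<lambda>f. f \<noteq> e \<and>
      \<not> list_ex (\<lambda>S. e \<in> set S \<and> f \<in> set S) petersen_pentagons) (labels_list 5)) \<le> 2) (labels_list 5)"
    by code_simp
  have remote: "card {f \<in> labels 5. f \<noteq> e \<and> (\<forall>i\<in>{..<length petersen_pentagons}. \<not> (e \<in> ?C i \<and> f \<in> ?C i))} \<le> 2"
    if "e \<in> labels 5" for e
  proof -
    let ?F = "filter (\<lambda>f. f \<noteq> e \<and> \<not> list_ex (\<lambda>S. e \<in> set S \<and> f \<in> set S) petersen_pentagons) (labels_list 5)"
    have "{f \<in> labels 5. f \<noteq> e \<and> (\<forall>i\<in>{..<length petersen_pentagons}. \<not> (e \<in> ?C i \<and> f \<in> ?C i))} = set ?F"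
      unfolding set_filter set_labels_list list_ex_iff bex_set_conv_nth by blast
    moreover have "card (set ?F) \<le> 2"
      using few that card_length[of ?F]
      by (auto simp: list_all_iff simp flip: set_labels_list)
    ultimately show ?thesis
      by simp
  qed
  have "card (c ` labels 5) + 5 \<le> card (labels 5)"
    using listed_pentagons[OF pentagons_5_2 pentagons_labels c] codeg deg remote
    by (intro colours_le_petersen_type[where C = ?C and I = "{..<length petersen_pentagons}"]) (simp_all add: len)
  then show "card (c ` labels 5) \<le> 10"
    by (simp add: card_labels)
qed simp

lemma max_colours_5_1: "max_colours (labels 5) (pentagons 5 1) = 13"
proof (rule max_colours_eqI)
  let ?r = "merge [Outer 0, Outer 1] \<circ> merge [Inner 0, Inner 1]"
  have "length (remdups (map ?r (labels_list 5))) = 13"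
    by code_simp
  then show "card (?r ` labels 5) = 13"
    by (simp only: card_image_set flip: set_labels_list)
  have "pentagons 5 1 = set ` set [outer_pentagon_list, inner_pentagon_list 1 0]"
    unfolding pentagons_5_1 list.set image_insert image_empty set_pentagon_lists ..
  moreover have hit: "list_all (\<lambda>S. list_ex (\<lambda>x. list_ex (\<lambda>y. x \<noteq> y \<and> ?r x = ?r y) S) S)
      [outer_pentagon_list, inner_pentagon_list 1 0]"
    by code_simp
  ultimately show "\<exists>x\<in>S. \<exists>y\<in>S. x \<noteq> y \<and> ?r x = ?r y" if "S \<in> pentagons 5 1" for S
    using not_rainbow_by_lists[OF hit] that by simp
next
  fix c :: "petersen_edge \<Rightarrow> nat"
  let ?C = "\<lambda>b. if b then outer_pentagon else inner_pentagon 1 0"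
  assume c: "\<And>S. S \<in> pentagons 5 1 \<Longrightarrow> \<not> inj_on c S"
  have "card {b \<in> UNIV. e \<in> ?C b} \<le> 1" for e
  proof -
    have "outer_pentagon \<inter> inner_pentagon 1 0 = {}"
      by (auto simp: outer_pentagon_def inner_pentagon_def)
    then show ?thesis
      by (auto simp: card_le_Suc0_iff_eq)
  qed
  then have "card (UNIV :: bool set) + 1 * card (c ` labels 5) \<le> 1 * card (labels 5)"
  proof (intro colours_le_degree[where C = ?C])
    fix b
    have "?C b \<in> pentagons 5 1"
      unfolding pentagons_5_1 by simp
    then show "?C b \<subseteq> labels 5" "\<not> inj_on c (?C b)"
      using c pentagons_labels by blast+
  qed simp_all
  then show "card (c ` labels 5) \<le> 13"
    by (simp add: card_labels)
qed simp

section \<open>The infinite families\<close>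

text \<open>
  The star at \<open>u\<close> with index $3j+2$ spoils the pentagons with indices $3j$, $3j+1$ and $3j+2$. With
  $q = \lfloor n/3 \rfloor$ such stars, up to two pentagons remain at the end, and each of them is spoiled by
  a pair consisting of its inner edge and an outer edge outside the stars. The set \<open>A\<close> contains
  all members of the classes except one representative per class, to which \<open>r\<close> sends them.
\<close>

lemma max_colours_two_outer:
  assumes n: "6 \<le> n" and \<P>: "pentagons n 2 = two_outer n ` {..<n}"
  shows "max_colours (labels n) (pentagons n 2) = 7 * n div 3"
proof -
  define q where "q = n div 3"
  define A where "A = (\<lambda>j. Outer (3 * j + 2)) ` {..<q} \<union> (\<lambda>j. Spoke (3 * j + 2)) ` {..<q} \<union> Inner ` {3 * q..<n}"
  define r where "r e = (if e \<in> A then case e of Outer i \<Rightarrow> Outer (i - 1) | Spoke i \<Rightarrow> Outer (i - 1) | Inner i \<Rightarrow> Outer i else e)" for e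
  have q: "3 * q \<le> n"
    by (simp add: q_def)
  have memA: "Outer i \<in> A \<longleftrightarrow> i mod 3 = 2 \<and> i < 3 * q" "Spoke i \<in> A \<longleftrightarrow> i mod 3 = 2 \<and> i < 3 * q"
    "Inner i \<in> A \<longleftrightarrow> 3 * q \<le> i \<and> i < n" for i
  proof -
    have "i mod 3 = 2 \<and> i < 3 * q \<longleftrightarrow> (\<exists>j<q. i = 3 * j + 2)"
    proof
      assume "i mod 3 = 2 \<and> i < 3 * q"
      then have "i = 3 * (i div 3) + 2" "i div 3 < q"
        using mult_div_mod_eq[of 3 i] by linarith+
      then show "\<exists>j<q. i = 3 * j + 2"
        by blast
    qed (elim exE conjE, presburger)
    then show "Outer i \<in> A \<longleftrightarrow> i mod 3 = 2 \<and> i < 3 * q" "Spoke i \<in> A \<longleftrightarrow> i mod 3 = 2 \<and> i < 3 * q"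
      "Inner i \<in> A \<longleftrightarrow> 3 * q \<le> i \<and> i < n"
      by (auto simp: A_def)
  qed
  have r: "i mod 3 = 2 \<Longrightarrow> i < 3 * q \<Longrightarrow> r (Outer i) = Outer (i - 1)"
    "i mod 3 = 2 \<Longrightarrow> i < 3 * q \<Longrightarrow> r (Spoke i) = Outer (i - 1)"
    "3 * q \<le> i \<Longrightarrow> i < n \<Longrightarrow> r (Inner i) = Outer i"
    "i mod 3 \<noteq> 2 \<or> 3 * q \<le> i \<Longrightarrow> r (Outer i) = Outer i" for i
    by (auto simp: r_def memA)
  have A: "A \<subseteq> labels n"
    using q by (auto simp: A_def)
  have cardA: "card A = 2 * q + (n - 3 * q)"
    unfolding A_def by (subst card_Un_disjoint; (subst card_Un_disjoint)?; auto simp: card_image inj_on_def)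
  show ?thesis
  proof (rule max_colours_eqI)
    have "r ` labels n = labels n - A"
    proof (rule retract_image[OF A])
      fix x assume x: "x \<in> A"
      show "r x \<in> labels n - A"
      proof (cases x)
        case (Outer i)
        then have "i mod 3 = 2" "i < 3 * q"
          using x by (simp_all add: memA)
        moreover from this(1) have "(i - 1) mod 3 \<noteq> 2"
          by (cases i) (simp_all add: mod_Suc split: if_splits)
        ultimately show ?thesis
          using q by (simp add: Outer r memA)
      next
        case (Spoke i)
        then have "i mod 3 = 2" "i < 3 * q"
          using x by (simp_all add: memA)
        moreover from this(1) have "(i - 1) mod 3 \<noteq> 2"
          by (cases i) (simp_all add: mod_Suc split: if_splits)
        ultimately show ?thesis
          using q by (simp add: Spoke r memA)
      next
        case (Inner i)
        then show ?thesis
          using x by (simp add: memA r)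
      qed
    qed (simp add: r_def)
    then have "card (r ` labels n) = 3 * n - card A"
      using A by (simp add: card_Diff_subset finite_subset[OF A] card_labels)
    also have "\<dots> = 7 * n div 3"
    proof -
      obtain s where s: "n = 3 * q + s" "s < 3"
        using that[of "n mod 3"] by (simp add: q_def)
      then have "s = 0 \<or> s = 1 \<or> s = 2"
        by linarith
      then show ?thesis
        unfolding cardA s(1) by auto
    qed
    finally show "card (r ` labels n) = 7 * n div 3" .
  next
    fix S assume "S \<in> pentagons n 2"
    then obtain i where i: "i < n" "S = two_outer n i"
      unfolding \<P> by blast
    consider "3 * q \<le> i" | "i < 3 * q" "i mod 3 = 0" | "i < 3 * q" "i mod 3 = 1" | "i < 3 * q" "i mod 3 = 2"
      by linarith
    then show "\<exists>x\<in>S. \<exists>y\<in>S. x \<noteq> y \<and> r x = r y"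
    proof cases
      case 1
      then show ?thesis
        using i by (intro bexI[of _ "Inner i"] bexI[of _ "Outer i"]) (simp_all add: r two_outer_mem)
    next
      case 2
      then have "i + 2 < 3 * q" "(i + 2) mod 3 = 2" "(i + 1) mod 3 \<noteq> 2"
        by presburger+
      then show ?thesis
        using i q by (intro bexI[of _ "Spoke (i + 2)"] bexI[of _ "Outer (i + 1)"])
          (simp_all add: r two_outer_mem)
    next
      case 3
      then have "i + 1 < 3 * q" "(i + 1) mod 3 = 2"
        by presburger+
      then show ?thesis
        using i q 3 by (intro bexI[of _ "Outer (i + 1)"] bexI[of _ "Outer i"])
          (simp_all add: r two_outer_mem)
    next
      case 4
      then show ?thesis
        using i by (intro bexI[of _ "Outer i"] bexI[of _ "Spoke i"]) (simp_all add: r two_outer_mem)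
    qed
  next
    fix c :: "petersen_edge \<Rightarrow> nat"
    assume c: "\<And>S. S \<in> pentagons n 2 \<Longrightarrow> \<not> inj_on c S"
    interpret petersen n 2
      using n by unfold_locales simp_all
    have "2 * card {..<n} + 3 * card (c ` labels n) \<le> 3 * card (labels n)"
    proof (rule colours_le_two_faced)
      show "two_outer n i \<subseteq> labels n" if "i \<in> {..<n}" for i
        using that by (simp add: two_outer_labels)
      show "\<not> inj_on c (two_outer n i)" if "i \<in> {..<n}" for i
        using that c unfolding \<P> by blast
      show "card {i \<in> {..<n}. e \<in> two_outer n i} \<le> 2" for e
        using n by (simp only: two_outer_degree)
    next
      fix e f i j
      assume "e \<noteq> f" "i \<in> {..<n}" "j \<in> {..<n}" "e \<in> two_outer n i" "f \<in> two_outer n i"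
        "e \<in> two_outer n j" "f \<in> two_outer n j"
      then show "i = j"
        using two_outer_codegree[of e f i j] n by simp
    qed simp_all
    then have "card (c ` labels n) * 3 \<le> 7 * n"
      by (simp add: card_labels)
    then show "card (c ` labels n) \<le> 7 * n div 3"
      by (simp add: less_eq_div_iff_mult_less_eq)
  qed simp
qed

lemma max_colours_two_inner:
  assumes n: "n = 2 * k + 1" and k: "3 \<le> k"
  shows "max_colours (labels n) (pentagons n k) = max_colours (labels n) (pentagons n 2)"
proof -
  have "pentagons n 2 = two_outer n ` {..<n}"
  proof -
    interpret petersen n 2
      using n k by unfold_locales simp_all
    have "5 * 2 \<noteq> n"
      using n by presburger
    then show ?thesis
      unfolding set_eq_iff pentagons_iff using n k by auto
  qed
  moreover have "pentagons n k = two_inner n k ` {..<n}"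
  proof -
    interpret petersen n k
      using n k by unfold_locales simp_all
    show ?thesis
      unfolding set_eq_iff pentagons_iff using n k by auto
  qed
  moreover have "(\<lambda>i. (2 * i) mod n) ` {..<n} = {..<n}"
  proof (rule endo_inj_surj)
    have "odd n"
      using n by simp
    show "inj_on (\<lambda>i. (2 * i) mod n) {..<n}"
    proof (rule inj_onI)
      fix i j assume "i \<in> {..<n}" "j \<in> {..<n}" "(2 * i) mod n = (2 * j) mod n"
      then show "i = j"
        using mod_inverse_2[OF \<open>odd n\<close>, of i j] by blast
    qed
  qed (use n in auto)
  moreover have "(\<lambda>i. relabel n ` two_inner n k i) ` {..<n} = two_outer n ` (\<lambda>i. (2 * i) mod n) ` {..<n}"
    unfolding relabel_two_inner[OF n] image_image ..
  ultimately have eq: "pentagons n 2 = (`) (relabel n) ` pentagons n k"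
    by (simp only: image_image)
  have "odd n"
    using n by simp
  show ?thesis
    unfolding eq using bij_relabel[OF \<open>odd n\<close>] pentagons_labels by (rule max_colours_transfer[symmetric])
qed

text \<open>
  The $g$ pentagons are disjoint, so one pair of equally coloured edges in each is necessary and
  sufficient.
\<close>

lemma max_colours_inner:
  assumes n: "n = 5 * g" and k: "k = g \<or> k = 2 * g" "3 \<le> k"
  shows "max_colours (labels n) (pentagons n k) = 14 * g"
proof -
  interpret petersen n k
    using n k by unfold_locales auto
  have g: "0 < g"
    using k by auto
  have "5 * k = n \<or> 5 * k = 2 * n" "n div 5 = g" "n \<noteq> 5" "k \<noteq> 2" "n \<noteq> 3" "n \<noteq> 2 * k + 1"
    using n k g by auto
  then have \<P>: "pentagons n k = inner_pentagon g ` {..<g}"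
    unfolding set_eq_iff pentagons_iff by auto
  define r where "r e = (case e of Inner i \<Rightarrow> if i < g then Inner (i + g) else e | _ \<Rightarrow> e)" for e
  have r: "i < g \<Longrightarrow> r (Inner i) = Inner (i + g)" "g \<le> i \<Longrightarrow> r (Inner i) = Inner i" for i
    by (auto simp: r_def)
  show ?thesis
  proof (rule max_colours_eqI)
    have sub: "Inner ` {..<g} \<subseteq> labels n"
      using n by auto
    have "r ` labels n = labels n - Inner ` {..<g}"
      using n by (intro retract_image[OF sub]) (auto simp: r r_def split: petersen_edge.splits)
    then show "card (r ` labels n) = 14 * g"
      using n sub by (simp add: card_Diff_subset card_labels card_image inj_on_def)
  next
    fix S assume "S \<in> pentagons n k"
    then obtain i where i: "i < g" "S = inner_pentagon g i"
      unfolding \<P> by blast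
    then show "\<exists>x\<in>S. \<exists>y\<in>S. x \<noteq> y \<and> r x = r y"
      using g by (intro bexI[of _ "Inner i"] bexI[of _ "Inner (i + g)"]) (auto simp: r inner_pentagon_mem)
  next
    fix c :: "petersen_edge \<Rightarrow> nat"
    assume c: "\<And>S. S \<in> pentagons n k \<Longrightarrow> \<not> inj_on c S"
    have "card {..<g} + 1 * card (c ` labels n) \<le> 1 * card (labels n)"
    proof (rule colours_le_degree)
      show "inner_pentagon g i \<subseteq> labels n" if "i \<in> {..<g}" for i
        using that by (intro inner_pentagon_labels n) simp_all
      show "\<not> inj_on c (inner_pentagon g i)" if "i \<in> {..<g}" for i
        using that c unfolding \<P> by blast
      show "card {i \<in> {..<g}. e \<in> inner_pentagon g i} \<le> 1" for e
        by (auto simp: card_le_Suc0_iff_eq inner_pentagon_mem)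
    qed simp_all
    then show "card (c ` labels n) \<le> 14 * g"
      using n by (simp add: card_labels)
  qed simp
qed

theorem theorem1p2:
  fixes n k :: nat
  assumes "n \<ge> 3" and "1 \<le> k" and "int k \<le> \<lfloor>(real n - 1) / 2\<rfloor>"
  shows "real (anti_ramsey (gen_petersen n k) (cycle_graph 5)) =
    (if n = 3 \<and> k = 1 then 7
     else if n = 5 \<and> k = 1 then 13
     else if n = 5 \<and> k = 2 then 10
     else if n = 10 \<and> k = 2 then 22
     else if (n \<ge> 6 \<and> n \<noteq> 10 \<and> k = 2) \<or> (real k = (real n - 1) / 2 \<and> k \<ge> 3)
       then of_int \<lfloor>7 * real n / 3\<rfloor>
     else if k \<ge> 3 \<and> real k \<in> {real n / 5, 2 * real n / 5} then 14 * real n / 5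
     else 3 * real n)"
proof -
  have "real k \<le> (real n - 1) / 2"
    using assms(3) by (simp add: le_floor_iff)
  then have kn: "2 * k + 1 \<le> n"
    by simp
  then interpret petersen n k
    using assms by unfold_locales simp_all
  have half: "real k = (real n - 1) / 2 \<longleftrightarrow> n = 2 * k + 1"
    by (auto simp: field_simps)
  have fifths: "real k \<in> {real n / 5, 2 * real n / 5} \<longleftrightarrow> 5 * k = n \<or> 5 * k = 2 * n"
    by (auto simp: field_simps)
  have floor: "of_int \<lfloor>7 * real n / 3\<rfloor> = real (7 * n div 3)"
    using floor_divide_of_nat_eq[of "7 * n" 3, where ?'a = real] by simp
  have main: "max_colours (labels n) (pentagons n k) =
    (if n = 3 \<and> k = 1 then 7
     else if n = 5 \<and> k = 1 then 13
     else if n = 5 \<and> k = 2 then 10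
     else if n = 10 \<and> k = 2 then 22
     else if (n \<ge> 6 \<and> n \<noteq> 10 \<and> k = 2) \<or> (n = 2 * k + 1 \<and> k \<ge> 3) then 7 * n div 3
     else if k \<ge> 3 \<and> (5 * k = n \<or> 5 * k = 2 * n) then 14 * (n div 5)
     else 3 * n)"
  proof -
    have generic: "max_colours (labels m) (pentagons m 2) = 7 * m div 3" if "6 \<le> m" "m \<noteq> 10" for m
    proof (rule max_colours_two_outer[OF that(1)])
      interpret two: petersen m 2
        using that by unfold_locales simp_all
      show "pentagons m 2 = two_outer m ` {..<m}"
        unfolding set_eq_iff two.pentagons_iff using that by auto
    qed
    consider "n = 3" "k = 1" | "n = 5" "k = 1" | "n = 5" "k = 2" | "n = 10" "k = 2"
      | "6 \<le> n" "n \<noteq> 10" "k = 2" | "n = 2 * k + 1" "3 \<le> k" | "3 \<le> k" "5 * k = n \<or> 5 * k = 2 * n"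
      | "k = 1" "n \<noteq> 3" "n \<noteq> 5" | "3 \<le> k" "n \<noteq> 2 * k + 1" "5 * k \<noteq> n" "5 * k \<noteq> 2 * n"
    proof -
      have "k = 1 \<or> k = 2 \<or> 3 \<le> k" "k = 2 \<Longrightarrow> n = 5 \<or> 6 \<le> n"
        using k1 kn by linarith+
      then show ?thesis
        using that by blast
    qed
    then show ?thesis
    proof cases
      case 1
      show ?thesis
        unfolding 1 max_colours_3_1 by simp
    next
      case 2
      show ?thesis
        unfolding 2 max_colours_5_1 by simp
    next
      case 3
      show ?thesis
        unfolding 3 max_colours_5_2 by simp
    next
      case 4
      show ?thesis
        unfolding 4 max_colours_10_2 by simp
    next
      case 5
      then show ?thesis
        by (simp add: generic)
    next
      case 6
      have "max_colours (labels n) (pentagons n k) = 7 * n div 3"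
        unfolding max_colours_two_inner[OF 6] using 6 by (intro generic) presburger+
      then show ?thesis
        using 6 by simp
    next
      case 7
      then have "n \<noteq> 2 * k + 1"
        by presburger
      then show ?thesis
        using 7 max_colours_inner[OF fifth_or_two_fifths[OF 7(2)] 7(1)] by simp
    next
      case 8
      then have "pentagons n k = {}"
        unfolding set_eq_iff pentagons_iff using kn by auto
      then show ?thesis
        using 8 by (simp add: max_colours_empty card_labels)
    next
      case 9
      then have "pentagons n k = {}"
        unfolding set_eq_iff pentagons_iff using kn by auto
      then show ?thesis
        using 9 by (simp add: max_colours_empty card_labels)
    qed
  qed
  have div5: "5 * real (n div 5) = real n" if "5 * k = n \<or> 5 * k = 2 * n"
    using arg_cong[OF fifth_or_two_fifths(1)[OF that], of real] by simp
  show ?thesis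
    unfolding anti_ramsey_eq_max_colours main half fifths floor
    using div5 by auto
qed

end
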